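(* Let $|\chi\rangle^{AB}$ and $|\upsilon\rangle^{AB}$ be two bipartite shared states. There is a quantum communication protocol $\mathcal{M}_{\chi\rightarrow\upsilon}$ which can prepare $|\upsilon\rangle$ from $|\chi\rangle$, using only $4\lceil d_\infty(|\chi\rangle,|\upsilon\rangle)\rceil+8$ qubits of communication.
   Context: Bipartite pure states are shared between parties $A$ (Alice) and $B$ (Bob) and, without loss of generality up to local unitaries, are written in Schmidt form $|\chi\rangle^{AB}=\sum_{i\in X}\sqrt{\chi_i}\,|i\rangle^A\otimes|i\rangle^B$ and $|\upsilon\rangle^{AB}=\sum_{j\in Y}\sqrt{\upsilon_j}\,|j\rangle^A\otimes|j\rangle^B$; the Schmidt coefficients are the numbers $\chi_i$, $\upsilon_j$ (the squares of the amplitudes), which are positive and sum to $1$. Logarithms are base $2$. $\ell_\infty$ Earth Mover's Distance: $d_\infty(|\chi\rangle,|\upsilon\rangle)$ is the minimum $\mu\ge 0$ for which there exists a joint distribution $\omega:X\times Y\to\mathbb{R}_{\ge 0}$ such that (i) $\sum_{j\in Y}\omega(i,j)=\chi_i$ for all $i\in X$; (ii) $\sum_{i\in X}\omega(i,j)=\upsilon_j$ for all $j\in Y$; (iii) $\omega(i,j)=0$ whenever $|\log(\chi_i)-\log(\upsilon_j)|>\mu$. A quantum communication protocol consists of the two parties appending local ancillas, applying local unitaries, and sending qubits to each other; its cost is the total number of qubits sent in either direction. *)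

theory Defs
  imports Complex_Main "Jordan_Normal_Form.Schur_Decomposition"
begin

(* A bipartite pure state in C^m (x) C^n (Alice (x) Bob) is represented by its m x n matrix of
   amplitudes: psi stands for  SUM a b. psi $$ (a,b) |a>|b>,  with the local dimensions
   m = dim_row psi and n = dim_col psi. *)

type_synonym bstate = "complex mat"

definition orthonormal_family :: "nat \<Rightarrow> 'i set \<Rightarrow> ('i \<Rightarrow> complex vec) \<Rightarrow> bool" where
  "orthonormal_family n X e \<longleftrightarrow>
     (\<forall>i\<in>X. e i \<in> carrier_vec n) \<and>
     (\<forall>i\<in>X. \<forall>j\<in>X. e i \<bullet>c e j = (if i = j then 1 else 0))"

(* psi = SUM i:X. sqrt (p i) e_i (x) f_i, where e_i and f_i are the (local, orthonormal) Schmidt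
   vectors; the numbers p i are the Schmidt coefficients, i.e. the squares of the amplitudes. *)
definition schmidt_form :: "bstate \<Rightarrow> 'i set \<Rightarrow> ('i \<Rightarrow> real) \<Rightarrow> bool" where
  "schmidt_form \<psi> X p \<longleftrightarrow>
     finite X \<and> (\<forall>i\<in>X. 0 < p i) \<and> (\<Sum>i\<in>X. p i) = 1 \<and>
     (\<exists>e f. orthonormal_family (dim_row \<psi>) X e \<and> orthonormal_family (dim_col \<psi>) X f \<and>
        \<psi> = mat (dim_row \<psi>) (dim_col \<psi>)
              (\<lambda>(a, b). \<Sum>i\<in>X. complex_of_real (sqrt (p i)) * (e i $ a) * (f i $ b)))"


definition transport_plan ::
  "'x set \<Rightarrow> ('x \<Rightarrow> real) \<Rightarrow> 'y set \<Rightarrow> ('y \<Rightarrow> real) \<Rightarrow> real \<Rightarrow> ('x \<Rightarrow> 'y \<Rightarrow> real) \<Rightarrow> bool" where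
  "transport_plan X p Y q \<mu> \<omega> \<longleftrightarrow>
     (\<forall>i\<in>X. \<forall>j\<in>Y. 0 \<le> \<omega> i j) \<and>
     (\<forall>i\<in>X. (\<Sum>j\<in>Y. \<omega> i j) = p i) \<and>
     (\<forall>j\<in>Y. (\<Sum>i\<in>X. \<omega> i j) = q j) \<and>
     (\<forall>i\<in>X. \<forall>j\<in>Y. \<bar>log 2 (p i) - log 2 (q j)\<bar> > \<mu> \<longrightarrow> \<omega> i j = 0)"

definition d_infty :: "'x set \<Rightarrow> ('x \<Rightarrow> real) \<Rightarrow> 'y set \<Rightarrow> ('y \<Rightarrow> real) \<Rightarrow> real" where
  "d_infty X p Y q = (LEAST \<mu>. 0 \<le> \<mu> \<and> (\<exists>\<omega>. transport_plan X p Y q \<mu> \<omega>))"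

(* The minimum in d_infty is attained. *)
lemma d_infty_minimum:
  assumes "finite X" "finite Y" "\<forall>i\<in>X. 0 < p i" "\<forall>j\<in>Y. 0 < q j"
    and "(\<Sum>i\<in>X. p i) = 1" "(\<Sum>j\<in>Y. q j) = 1"
  shows "0 \<le> d_infty X p Y q" "\<exists>\<omega>. transport_plan X p Y q (d_infty X p Y q) \<omega>"
    and "\<And>\<mu> \<omega>. 0 \<le> \<mu> \<Longrightarrow> transport_plan X p Y q \<mu> \<omega> \<Longrightarrow> d_infty X p Y q \<le> \<mu>"
proof -
  let ?F = "\<lambda>\<mu>. 0 \<le> \<mu> \<and> (\<exists>\<omega>. transport_plan X p Y q \<mu> \<omega>)"
  define D where "D = insert 0 ((\<lambda>(i, j). \<bar>log 2 (p i) - log 2 (q j)\<bar>) ` (X \<times> Y))"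
  have fD: "finite D" unfolding D_def using assms by auto
  have D0: "\<And>d. d \<in> D \<Longrightarrow> 0 \<le> d" unfolding D_def by auto
  have round: "\<exists>d\<in>D. d \<le> \<mu> \<and> ?F d" if "?F \<mu>" for \<mu>
  proof -
    from that obtain \<omega> where m: "0 \<le> \<mu>" and w: "transport_plan X p Y q \<mu> \<omega>" by blast
    define d where "d = Max {d \<in> D. d \<le> \<mu>}"
    have fin: "finite {d \<in> D. d \<le> \<mu>}" using fD by auto
    have ne: "{d \<in> D. d \<le> \<mu>} \<noteq> {}" using m unfolding D_def by auto
    have d: "d \<in> D" "d \<le> \<mu>" using Max_in[OF fin ne] unfolding d_def by auto
    have "\<bar>log 2 (p i) - log 2 (q j)\<bar> > \<mu>"
      if "i \<in> X" "j \<in> Y" "\<bar>log 2 (p i) - log 2 (q j)\<bar> > d" for i j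
    proof (rule ccontr)
      assume "\<not> ?thesis"
      moreover have "\<bar>log 2 (p i) - log 2 (q j)\<bar> \<in> D" using that unfolding D_def by auto
      ultimately have "\<bar>log 2 (p i) - log 2 (q j)\<bar> \<le> d"
        unfolding d_def by (intro Max_ge[OF fin]) auto
      with that show False by simp
    qed
    then have "transport_plan X p Y q d \<omega>" using w unfolding transport_plan_def by blast
    with d D0 show ?thesis by blast
  qed
  have "transport_plan X p Y q (Max D) (\<lambda>i j. p i * q j)"
  proof -
    have "\<bar>log 2 (p i) - log 2 (q j)\<bar> \<le> Max D" if "i \<in> X" "j \<in> Y" for i j
      by (rule Max_ge[OF fD]) (use that in \<open>auto simp: D_def\<close>)
    then have far: "p i * q j = 0"
      if "i \<in> X" "j \<in> Y" "\<bar>log 2 (p i) - log 2 (q j)\<bar> > Max D" for i j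
      using that by (meson not_le)
    have nonneg: "0 \<le> p i * q j" if "i \<in> X" "j \<in> Y" for i j
      using assms(3,4) that by (simp add: less_imp_le)
    have "(\<Sum>j\<in>Y. p i * q j) = p i" for i
      using assms(6) by (simp flip: sum_distrib_left)
    moreover have "(\<Sum>i\<in>X. p i * q j) = q j" for j
      using assms(5) by (simp flip: sum_distrib_right)
    ultimately show ?thesis using far nonneg unfolding transport_plan_def by blast
  qed
  moreover have "Max D \<in> D" using fD unfolding D_def by (intro Max_in) auto
  ultimately have ne: "{d \<in> D. ?F d} \<noteq> {}" using D0 by blast
  define m where "m = Min {d \<in> D. ?F d}"
  have fm: "finite {d \<in> D. ?F d}" using fD by auto
  have Fm: "?F m" using Min_in[OF fm ne] unfolding m_def by blast
  have least: "m \<le> \<mu>" if F: "?F \<mu>" for \<mu>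
  proof -
    from round[OF F] obtain d where "d \<in> D" "d \<le> \<mu>" "?F d" by blast
    then show ?thesis unfolding m_def using Min_le[OF fm, of d] by auto
  qed
  have eq: "d_infty X p Y q = m"
    unfolding d_infty_def by (rule Least_equality) (use Fm least in auto)
  show "0 \<le> d_infty X p Y q" "\<exists>\<omega>. transport_plan X p Y q (d_infty X p Y q) \<omega>"
    using Fm unfolding eq by auto
  show "d_infty X p Y q \<le> \<mu>" if "0 \<le> \<mu>" "transport_plan X p Y q \<mu> \<omega>" for \<mu> \<omega>
    using least that unfolding eq by blast
qed


definition unitary_mat :: "nat \<Rightarrow> complex mat \<Rightarrow> bool" where
  "unitary_mat n U \<longleftrightarrow>
     U \<in> carrier_mat n n \<and> mat_adjoint U * U = 1\<^sub>m n \<and> U * mat_adjoint U = 1\<^sub>m n"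

(* A basis vector |a>|c> of C^m (x) C^k is encoded as |a * k + c> in C^(m*k).  Appending adjoins a
   k-dimensional local register in state |0>. *)
definition append_A :: "nat \<Rightarrow> bstate \<Rightarrow> bstate" where
  "append_A k \<psi> = mat (dim_row \<psi> * k) (dim_col \<psi>)
     (\<lambda>(a, b). if a mod k = 0 then \<psi> $$ (a div k, b) else 0)"

definition append_B :: "nat \<Rightarrow> bstate \<Rightarrow> bstate" where
  "append_B k \<psi> = mat (dim_row \<psi>) (dim_col \<psi> * k)
     (\<lambda>(a, b). if b mod k = 0 then \<psi> $$ (a, b div k) else 0)"

(* When the sender's dimension is 2 * m, his space is C^m (x) C^2, and the factor C^2 becomes the
   last tensor factor of the receiver's space.  Local unitaries can bring any qubit into this
   position. *)
definition send_AB :: "bstate \<Rightarrow> bstate" where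
  "send_AB \<psi> = mat (dim_row \<psi> div 2) (dim_col \<psi> * 2)
     (\<lambda>(a, b). \<psi> $$ (2 * a + b mod 2, b div 2))"

definition send_BA :: "bstate \<Rightarrow> bstate" where
  "send_BA \<psi> = mat (dim_row \<psi> * 2) (dim_col \<psi> div 2)
     (\<lambda>(a, b). \<psi> $$ (a div 2, 2 * b + a mod 2))"

datatype move =
    Ancilla_A nat
  | Ancilla_B nat
  | Unitary_A "complex mat"
  | Unitary_B "complex mat"
  | Send_AB
  | Send_BA

(* In terms of amplitude matrices, (U (x) I) psi is U * psi, and (I (x) V) psi is psi * V^T
   (transpose, without conjugation). *)
inductive move_step :: "move \<Rightarrow> bstate \<Rightarrow> bstate \<Rightarrow> bool" where
  ancilla_A: "0 < k \<Longrightarrow> move_step (Ancilla_A k) \<psi> (append_A k \<psi>)"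
| ancilla_B: "0 < k \<Longrightarrow> move_step (Ancilla_B k) \<psi> (append_B k \<psi>)"
| unitary_A: "unitary_mat (dim_row \<psi>) U \<Longrightarrow> move_step (Unitary_A U) \<psi> (U * \<psi>)"
| unitary_B: "unitary_mat (dim_col \<psi>) V \<Longrightarrow> move_step (Unitary_B V) \<psi> (\<psi> * transpose_mat V)"
| send_AB: "even (dim_row \<psi>) \<Longrightarrow> move_step Send_AB \<psi> (send_AB \<psi>)"
| send_BA: "even (dim_col \<psi>) \<Longrightarrow> move_step Send_BA \<psi> (send_BA \<psi>)"

type_synonym protocol = "move list"

inductive executes :: "protocol \<Rightarrow> bstate \<Rightarrow> bstate \<Rightarrow> bool" where
  executes_Nil: "executes [] \<psi> \<psi>"
| executes_Cons: "move_step s \<psi> \<phi> \<Longrightarrow> executes M \<phi> \<theta> \<Longrightarrow> executes (s # M) \<psi> \<theta>"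

definition qubit_cost :: "protocol \<Rightarrow> nat" where
  "qubit_cost M = length (filter (\<lambda>s. s = Send_AB \<or> s = Send_BA) M)"

(* The target is reached exactly, next to local ancillas left in |0>; the latter are unentangled
   with the target and with each other. *)
definition prepares :: "protocol \<Rightarrow> bstate \<Rightarrow> bstate \<Rightarrow> bool" where
  "prepares M \<chi> \<upsilon> \<longleftrightarrow>
     (\<exists>k l. 0 < k \<and> 0 < l \<and> executes M \<chi> (append_A k (append_B l \<upsilon>)))"

end

theory Submission
  imports Defs
begin

text \<open>Sort both spectra decreasingly and couple them by overlapping intervals. On the line this
  coupling is optimal for the supremum cost, so it still moves every coefficient by at most a
  factor \<open>2\<^sup>d\<close>, where \<open>d\<close> is the distance; being monotone, its support has rows and columns contained
  in windows of at most \<open>2\<^sup>k + 1\<close> consecutive indices, \<open>k = \<lceil>d\<rceil>\<close>. Hence \<open>(i + j) mod D\<close> with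
  \<open>D = 2\<^sup>k\<^sup>+\<^sup>1\<close> is a proper edge colouring \<open>t\<close> of the support. Alice maps \<open>e\<^sub>i\<close> to
  \<open>\<Sum>\<^sub>j \<surd>(\<omega>\<^sub>i\<^sub>j / p\<^sub>i) e'\<^sub>j \<otimes> |t\<^sub>i\<^sub>j\<rangle>\<close> and sends the colour register; Bob then holds
  \<open>\<Sum>\<^sub>i \<surd>(\<omega>\<^sub>i\<^sub>j / q\<^sub>j) f\<^sub>i \<otimes> |t\<^sub>i\<^sub>j\<rangle>\<close> next to each \<open>e'\<^sub>j\<close>. Properness of the colouring makes both
  families orthonormal, so both maps are local unitaries, and the one-way cost is \<open>\<lceil>d\<rceil> + 1\<close> qubits.\<close>

section \<open>Unitaries between orthonormal families\<close>

lemma mat_adjoint_index: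
  fixes A :: "complex mat"
  assumes "i < dim_col A" "j < dim_row A"
  shows "mat_adjoint A $$ (i, j) = cnj (A $$ (j, i))"
  using assms by (simp add: mat_adjoint_def mat_of_rows_index)

lemma mat_adjoint_dim [simp]:
  fixes A :: "complex mat"
  shows "dim_row (mat_adjoint A) = dim_col A" "dim_col (mat_adjoint A) = dim_row A"
  by (simp_all add: mat_adjoint_def)

lemma mat_adjoint_mult:
  fixes A B :: "complex mat"
  assumes "A \<in> carrier_mat n m" "B \<in> carrier_mat m k"
  shows "mat_adjoint (A * B) = mat_adjoint B * mat_adjoint A"
  by (rule eq_matI)
    (use assms in \<open>auto simp: mat_adjoint_index scalar_prod_def mult.commute\<close>)

text \<open>For square matrices a left inverse is also a right inverse, so one of the two identities
  in \<open>unitary_mat\<close> settles both.\<close>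

lemma unitary_matI:
  assumes U: "U \<in> carrier_mat n n" and eq: "mat_adjoint U * U = 1\<^sub>m n"
  shows "unitary_mat n U"
proof -
  have "mat_adjoint U \<in> carrier_mat n n" using U by auto
  then show ?thesis
    using mat_mult_left_right_inverse[OF _ U eq] U eq by (simp add: unitary_mat_def)
qed

lemma unitary_mat_one: "unitary_mat n (1\<^sub>m n)"
proof (rule unitary_matI)
  have "mat_adjoint (1\<^sub>m n) = (1\<^sub>m n :: complex mat)"
    by (rule eq_matI) (auto simp: mat_adjoint_index)
  then show "mat_adjoint (1\<^sub>m n) * 1\<^sub>m n = (1\<^sub>m n :: complex mat)" by simp
qed simp

lemma unitary_mat_mult:
  assumes "unitary_mat n U" "unitary_mat n V"
  shows "unitary_mat n (U * V)"
proof (rule unitary_matI)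
  have U: "U \<in> carrier_mat n n" "mat_adjoint U * U = 1\<^sub>m n"
    and V: "V \<in> carrier_mat n n" "mat_adjoint V * V = 1\<^sub>m n"
    using assms by (auto simp: unitary_mat_def)
  have aU: "mat_adjoint U \<in> carrier_mat n n" and aV: "mat_adjoint V \<in> carrier_mat n n"
    using U V by auto
  have "mat_adjoint (U * V) * (U * V) = mat_adjoint V * (mat_adjoint U * U * V)"
    by (simp only: mat_adjoint_mult[OF U(1) V(1)] assoc_mult_mat[OF aV aU mult_carrier_mat[OF U(1) V(1)]]
        assoc_mult_mat[OF aU U(1) V(1)])
  also have "\<dots> = 1\<^sub>m n" unfolding U(2) using V by simp
  finally show "mat_adjoint (U * V) * (U * V) = 1\<^sub>m n" .
  show "U * V \<in> carrier_mat n n" using U V by simp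
qed

section \<open>Inner products and reflection-type unitaries\<close>

lemma cscalar_prod_sum:
  fixes v w :: "complex vec"
  assumes "w \<in> carrier_vec n"
  shows "v \<bullet>c w = (\<Sum>k<n. v $ k * cnj (w $ k))"
  using assms by (auto simp: scalar_prod_def lessThan_atLeast0)

text \<open>In \<open>W\<^sup>* W\<close> the coefficient of \<open>s $ i * cnj (s $ j)\<close> is
  \<open>- 1 / z - 1 / cnj z + (s \<bullet>c s) / (z * cnj z)\<close>; the norm condition is exactly
  what makes it vanish.\<close>

lemma householder_unitary:
  fixes s :: "complex vec"
  assumes s: "s \<in> carrier_vec n" and z: "z \<noteq> 0" and norm: "s \<bullet>c s = z + cnj z"
  shows "unitary_mat n (mat n n (\<lambda>(i, j). (if i = j then 1 else 0) - s $ i * cnj (s $ j) / z))"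
    (is "unitary_mat n ?W")
proof (rule unitary_matI)
  have S: "(\<Sum>k<n. s $ k * cnj (s $ k)) = z + cnj z"
    using norm by (simp add: cscalar_prod_sum[OF s])
  show "mat_adjoint ?W * ?W = 1\<^sub>m n"
  proof (rule eq_matI)
    fix i j assume "i < dim_row (1\<^sub>m n :: complex mat)" "j < dim_col (1\<^sub>m n :: complex mat)"
    then have ij: "i < n" "j < n" by auto
    have "(mat_adjoint ?W * ?W) $$ (i, j) = (\<Sum>k<n. cnj (?W $$ (k, i)) * ?W $$ (k, j))"
      using ij by (auto simp: scalar_prod_def mat_adjoint_index lessThan_atLeast0)
    also have "\<dots> = (\<Sum>k<n. (if k = i then (if k = j then 1 else 0) else 0)
        - (if k = i then s $ k * cnj (s $ j) / z else 0)
        - (if k = j then cnj (s $ k) * s $ i / cnj z else 0)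
        + (s $ k * cnj (s $ k)) * (s $ i * cnj (s $ j) / (z * cnj z)))"
      by (rule sum.cong) (use ij in \<open>auto simp: algebra_simps\<close>)
    also have "\<dots> = (if i = j then 1 else 0) - s $ i * cnj (s $ j) / z - cnj (s $ j) * s $ i / cnj z
        + (z + cnj z) * (s $ i * cnj (s $ j) / (z * cnj z))"
      using ij by (simp add: sum.distrib sum_subtractf S del: times_divide_eq_right flip: sum_distrib_right)
    also have "\<dots> = (if i = j then 1 else 0)"
      using z by (simp add: field_simps)
    finally show "(mat_adjoint ?W * ?W) $$ (i, j) = 1\<^sub>m n $$ (i, j)" using ij by simp
  qed auto
qed simp

lemma householder_apply:
  fixes s x :: "complex vec"
  assumes "s \<in> carrier_vec n" "x \<in> carrier_vec n"
  shows "mat n n (\<lambda>(i, j). (if i = j then 1 else 0) - s $ i * cnj (s $ j) / z) *\<^sub>v x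
    = x - ((x \<bullet>c s) / z) \<cdot>\<^sub>v s"
proof (rule eq_vecI)
  fix i assume "i < dim_vec (x - ((x \<bullet>c s) / z) \<cdot>\<^sub>v s)"
  then have i: "i < n" using assms by auto
  have "(mat n n (\<lambda>(i, j). (if i = j then 1 else 0) - s $ i * cnj (s $ j) / z) *\<^sub>v x) $ i
     = (\<Sum>j<n. ((if i = j then 1 else 0) - s $ i * cnj (s $ j) / z) * x $ j)"
    using i assms by (auto simp: scalar_prod_def lessThan_atLeast0)
  also have "\<dots> = (\<Sum>j<n. (if j = i then x $ j else 0) - (x $ j * cnj (s $ j)) * (s $ i / z))"
    by (rule sum.cong) (auto simp: algebra_simps)
  also have "\<dots> = x $ i - (x \<bullet>c s) * (s $ i / z)"
    using i by (simp add: sum_subtractf cscalar_prod_sum[OF assms(1)] del: times_divide_eq_right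
        flip: sum_distrib_right)
  finally show "(mat n n (\<lambda>(i, j). (if i = j then 1 else 0) - s $ i * cnj (s $ j) / z) *\<^sub>v x) $ i
     = (x - ((x \<bullet>c s) / z) \<cdot>\<^sub>v s) $ i"
    using i assms by simp
qed (use assms in auto)

text \<open>\<open>W = I - s s\<^sup>* / (s\<^sup>* u)\<close> with \<open>s = u - w\<close>, the complex analogue of a Householder reflection.\<close>

lemma unitary_map_unit_vec:
  fixes u w :: "complex vec"
  assumes u: "u \<in> carrier_vec n" and w: "w \<in> carrier_vec n" and norm: "u \<bullet>c u = 1" "w \<bullet>c w = 1"
  shows "\<exists>W. unitary_mat n W \<and> W *\<^sub>v u = w \<and>
    (\<forall>x \<in> carrier_vec n. x \<bullet>c u = 0 \<longrightarrow> x \<bullet>c w = 0 \<longrightarrow> W *\<^sub>v x = x)"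
proof (cases "u = w")
  case True
  then show ?thesis using u unitary_mat_one by (intro exI[of _ "1\<^sub>m n"]) auto
next
  case False
  define s where "s = u - w"
  define z where "z = u \<bullet>c s"
  have s: "s \<in> carrier_vec n" using u w by (simp add: s_def)
  have right: "x \<bullet>c s = x \<bullet>c u - x \<bullet>c w" if "x \<in> carrier_vec n" for x
    unfolding cscalar_prod_sum[OF s] cscalar_prod_sum[OF u] cscalar_prod_sum[OF w]
    using u w by (simp add: s_def algebra_simps flip: sum_subtractf)
  have left: "s \<bullet>c x = u \<bullet>c x - w \<bullet>c x" if x: "x \<in> carrier_vec n" for x
    unfolding cscalar_prod_sum[OF x]
    using u w by (simp add: s_def algebra_simps flip: sum_subtractf)
  have cnj: "cnj (u \<bullet>c w) = w \<bullet>c u"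
    by (simp add: cscalar_prod_sum[OF u] cscalar_prod_sum[OF w] mult.commute)
  have z_eq: "z = 1 - u \<bullet>c w" using right[OF u] norm by (simp add: z_def)
  \<comment> \<open>Both \<open>u\<close> and \<open>w\<close> have norm 1, so
    \<open>s \<bullet>c s\<close> is \<open>2 - u \<bullet>c w - w \<bullet>c u\<close>, as the norm
    condition of \<open>householder_unitary\<close> demands.\<close>
  have ss: "s \<bullet>c s = z + cnj z"
    using left[OF s] right[OF u] right[OF w] norm cnj by (simp add: z_eq)
  have z0: "z \<noteq> 0"
  proof
    assume "z = 0"
    then have "s \<bullet>c s = 0" using ss by simp
    then have "s = 0\<^sub>v n" using conjugate_square_eq_0_vec[OF s] by simp
    then have "s $ k = 0" if "k < n" for k using that by simp
    then have "u $ k = w $ k" if "k < n" for k using that u w by (simp add: s_def)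
    with False u w show False by (auto intro: eq_vecI)
  qed
  let ?W = "mat n n (\<lambda>(i, j). (if i = j then 1 else 0) - s $ i * cnj (s $ j) / z)"
  show ?thesis
  proof (intro exI conjI ballI impI)
    show "unitary_mat n ?W" by (rule householder_unitary[OF s z0 ss])
    \<comment> \<open>The coefficient of \<open>s\<close> in \<open>householder_apply\<close> is
      \<open>z / z = 1\<close>, which leaves \<open>u - s = w\<close>.\<close>
    show "?W *\<^sub>v u = w"
      unfolding householder_apply[OF s u] z_def[symmetric] using z0 u w
      by (intro eq_vecI) (auto simp: s_def)
    show "?W *\<^sub>v x = x" if x: "x \<in> carrier_vec n" and "x \<bullet>c u = 0" "x \<bullet>c w = 0" for x
      unfolding householder_apply[OF s x] using x s right[OF x] that(2,3) by auto
  qed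
qed

lemma cscalar_prod_unitary:
  assumes U: "unitary_mat n U" and v: "v \<in> carrier_vec n" and w: "w \<in> carrier_vec n"
  shows "(U *\<^sub>v v) \<bullet>c (U *\<^sub>v w) = v \<bullet>c w"
proof -
  have U': "U \<in> carrier_mat n n" "mat_adjoint U * U = 1\<^sub>m n" "mat_adjoint U \<in> carrier_mat n n"
    using U by (auto simp: unitary_mat_def)
  have Uv: "U *\<^sub>v v \<in> carrier_vec n" and Uw: "U *\<^sub>v w \<in> carrier_vec n" using U' v w by auto
  have "(U *\<^sub>v v) \<bullet>c (U *\<^sub>v w) = (\<Sum>k<n. (U *\<^sub>v v) $ k * (\<Sum>l<n. cnj (U $$ (k, l)) * cnj (w $ l)))"
    unfolding cscalar_prod_sum[OF Uw] using U' w
    by (intro sum.cong) (auto simp: scalar_prod_def lessThan_atLeast0)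
  also have "\<dots> = (\<Sum>l<n. (\<Sum>k<n. cnj (U $$ (k, l)) * (U *\<^sub>v v) $ k) * cnj (w $ l))"
    unfolding sum_distrib_left sum_distrib_right by (subst sum.swap) (simp add: mult_ac)
  also have "\<dots> = (\<Sum>l<n. (mat_adjoint U *\<^sub>v (U *\<^sub>v v)) $ l * cnj (w $ l))"
    using U' by (intro sum.cong) (auto simp: scalar_prod_def mat_adjoint_index lessThan_atLeast0)
  also have "mat_adjoint U *\<^sub>v (U *\<^sub>v v) = v"
    using U' v assoc_mult_mat_vec[OF U'(3,1) v] by simp
  finally show ?thesis by (simp add: cscalar_prod_sum[OF w])
qed

text \<open>Induction on the family, without completing it to a basis: the unitary \<open>U\<close>
  found so far is followed by a \<open>W\<close> that turns \<open>U *\<^sub>v e a\<close> into the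
  new target \<open>f a\<close> and leaves the earlier targets alone.\<close>

lemma unitary_between_orthonormal_families:
  assumes "finite X" "orthonormal_family n X e" "orthonormal_family n X f"
  shows "\<exists>U. unitary_mat n U \<and> (\<forall>i\<in>X. U *\<^sub>v e i = f i)"
  using assms
proof (induction X rule: finite_induct)
  case empty
  then show ?case using unitary_mat_one by blast
next
  case (insert a X)
  have e: "e i \<in> carrier_vec n" "f i \<in> carrier_vec n" if "i \<in> insert a X" for i
    using insert.prems that by (auto simp: orthonormal_family_def)
  have orth: "f i \<bullet>c f a = 0" "e i \<bullet>c e a = 0" if "i \<in> X" for i
    using insert.prems insert.hyps that by (auto simp: orthonormal_family_def)
  have unit: "f a \<bullet>c f a = 1" "e a \<bullet>c e a = 1"
    using insert.prems by (auto simp: orthonormal_family_def)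
  obtain U where U: "unitary_mat n U" "\<forall>i\<in>X. U *\<^sub>v e i = f i"
    using insert by (auto simp: orthonormal_family_def)
  have Uc: "U \<in> carrier_mat n n" using U(1) by (simp add: unitary_mat_def)
  have Ua: "U *\<^sub>v e a \<in> carrier_vec n" using Uc e by auto
  obtain W where W: "unitary_mat n W" "W *\<^sub>v (U *\<^sub>v e a) = f a"
    "\<forall>x \<in> carrier_vec n. x \<bullet>c (U *\<^sub>v e a) = 0 \<longrightarrow> x \<bullet>c f a = 0 \<longrightarrow> W *\<^sub>v x = x"
    using unitary_map_unit_vec[OF Ua e(2)[of a]] unit cscalar_prod_unitary[OF U(1) e(1) e(1), of a a]
    by auto
  have Wc: "W \<in> carrier_mat n n" using W(1) by (simp add: unitary_mat_def)
  \<comment> \<open>\<open>f i\<close> is orthogonal to \<open>f a\<close> by assumption and to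
    \<open>U *\<^sub>v e a\<close> because \<open>U\<close> preserves inner products, so
    \<open>W\<close> fixes it.\<close>
  have "W *\<^sub>v f i = f i" if i: "i \<in> X" for i
  proof -
    have "f i \<bullet>c (U *\<^sub>v e a) = (U *\<^sub>v e i) \<bullet>c (U *\<^sub>v e a)" using U i by simp
    also have "\<dots> = 0" using cscalar_prod_unitary[OF U(1) e(1) e(1), of i a] orth i by simp
    finally show ?thesis using W(3) orth i e by auto
  qed
  then have "(W * U) *\<^sub>v e i = f i" if "i \<in> insert a X" for i
    using that U(2) W(2) assoc_mult_mat_vec[OF Wc Uc e(1)[OF that]] by auto
  then show ?case using unitary_mat_mult[OF W(1) U(1)] by blast
qed

section \<open>The monotone coupling\<close>

lemma transport_plan_swap:
  "transport_plan Y q X p \<mu> (\<lambda>j i. \<omega> i j) \<longleftrightarrow> transport_plan X p Y q \<mu> \<omega>"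
  by (auto simp: transport_plan_def abs_minus_commute)

text \<open>Length of the intersection of the intervals from \<open>a\<close> to \<open>a'\<close>
  and from \<open>b\<close> to \<open>b'\<close>, written as a mixed second difference of
  \<open>min\<close>; in this form sums over adjacent intervals telescope.\<close>

definition overlap :: "real \<Rightarrow> real \<Rightarrow> real \<Rightarrow> real \<Rightarrow> real" where
  "overlap a a' b b' = min a' b' - min a b' - min a' b + min a b"

lemma overlap_nonneg: "a \<le> a' \<Longrightarrow> b \<le> b' \<Longrightarrow> 0 \<le> overlap a a' b b'"
  by (auto simp: overlap_def min_def)

lemma overlap_swap: "overlap a a' b b' = overlap b b' a a'"
  by (simp add: overlap_def min.commute)

lemma overlap_eq_0: "a \<le> a' \<Longrightarrow> b \<le> b' \<Longrightarrow> a' \<le> b \<Longrightarrow> overlap a a' b b' = 0"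
  by (auto simp: overlap_def min_def)

text \<open>The sum telescopes to \<open>h m - h 0\<close>. Here \<open>h 0\<close> is 0 because
  neither \<open>a\<close> nor \<open>a'\<close> is negative, and \<open>h m\<close> is
  \<open>a' - a\<close> because neither exceeds the total.\<close>

lemma sum_overlap:
  fixes q :: "nat \<Rightarrow> real"
  assumes "0 \<le> a" "a \<le> a'" "a' \<le> (\<Sum>l<m. q l)"
  shows "(\<Sum>j<m. overlap a a' (\<Sum>l<j. q l) (\<Sum>l<Suc j. q l)) = a' - a"
proof -
  define h where "h j = min a' (\<Sum>l<j. q l) - min a (\<Sum>l<j. q l)" for j
  have "(\<Sum>j<m. overlap a a' (\<Sum>l<j. q l) (\<Sum>l<Suc j. q l)) = (\<Sum>j<m. h (Suc j) - h j)"
    by (rule sum.cong) (auto simp: overlap_def h_def)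
  also have "\<dots> = h m - h 0" by (rule sum_lessThan_telescope)
  also have "\<dots> = a' - a" using assms by (simp add: h_def)
  finally show ?thesis .
qed

text \<open>The source of optimality of the sorted coupling. If \<open>p i\<close> exceeds
  \<open>q j\<close> by more than the factor 2 to the power \<mu>, then so does every earlier
  \<open>p i'\<close> over every later \<open>q j'\<close>. Any plan must therefore fit the mass of
  the rows up to \<open>i\<close> into the columns before \<open>j\<close>.\<close>

lemma transport_plan_cumulative_le:
  fixes p q :: "nat \<Rightarrow> real"
  assumes plan: "transport_plan {..<n} p {..<m} q \<mu> \<omega>"
    and p: "\<forall>i<n. 0 < p i" "\<forall>i i'. i \<le> i' \<longrightarrow> i' < n \<longrightarrow> p i' \<le> p i"
    and q: "\<forall>j<m. 0 < q j" "\<forall>j j'. j \<le> j' \<longrightarrow> j' < m \<longrightarrow> q j' \<le> q j"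
    and i: "i < n" and j: "j < m" and far: "log 2 (p i) - log 2 (q j) > \<mu>"
  shows "(\<Sum>l<Suc i. p l) \<le> (\<Sum>l<j. q l)"
proof -
  have zero: "\<omega> i' j' = 0" if "i' \<le> i" "j \<le> j'" "j' < m" for i' j'
  proof -
    have "i' < n" using that(1) i by simp
    then have "0 < p i" "0 < p i'" "p i \<le> p i'" "0 < q j" "0 < q j'" "q j' \<le> q j"
      using p q i j that by blast+
    then have "log 2 (p i) \<le> log 2 (p i')" "log 2 (q j') \<le> log 2 (q j)" by simp_all
    then have "\<bar>log 2 (p i') - log 2 (q j')\<bar> > \<mu>" using far by linarith
    then show ?thesis using plan that i by (auto simp: transport_plan_def)
  qed
  have "(\<Sum>l<Suc i. p l) = (\<Sum>i'<Suc i. \<Sum>j'<m. \<omega> i' j')"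
    using plan i by (intro sum.cong) (auto simp: transport_plan_def)
  also have "\<dots> = (\<Sum>i'<Suc i. \<Sum>j'<j. \<omega> i' j')"
    by (rule sum.cong[OF refl], rule sum.mono_neutral_right) (use zero j in auto)
  also have "\<dots> = (\<Sum>j'<j. \<Sum>i'<Suc i. \<omega> i' j')" by (rule sum.swap)
  also have "\<dots> \<le> (\<Sum>j'<j. \<Sum>i'<n. \<omega> i' j')"
    by (rule sum_mono, rule sum_mono2) (use plan i less_trans[OF _ j] in \<open>auto simp: transport_plan_def\<close>)
  also have "\<dots> = (\<Sum>j'<j. q j')"
    using plan j by (intro sum.cong) (auto simp: transport_plan_def)
  finally show ?thesis .
qed

text \<open>The columns strictly between \<open>j\<close> and \<open>j'\<close> lie wholly inside
  the interval of row \<open>i\<close>, and each has mass at least \<open>q j'\<close>, hence at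
  least \<open>p i\<close> divided by \<open>2 ^ nat \<lceil>\<mu>\<rceil>\<close>. So there are
  fewer than \<open>2 ^ nat \<lceil>\<mu>\<rceil>\<close> of them.\<close>

lemma monotone_coupling_window:
  fixes p q :: "nat \<Rightarrow> real"
  assumes pi: "0 < p i"
    and q: "\<forall>j<m. 0 < q j" "\<forall>j j'. j \<le> j' \<longrightarrow> j' < m \<longrightarrow> q j' \<le> q j"
    and m: "j' < m" and less: "j < j'"
    and meets: "(\<Sum>l<i. p l) < (\<Sum>l<Suc j. q l)" "(\<Sum>l<j'. q l) < (\<Sum>l<Suc i. p l)"
    and near: "log 2 (p i) - log 2 (q j') \<le> \<mu>"
  shows "j' - j \<le> 2 ^ nat \<lceil>\<mu>\<rceil>"
proof -
  define K where "K = nat \<lceil>\<mu>\<rceil>"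
  have qj: "0 < q j'" using q(1) m by blast
  have "log 2 (p i) \<le> log 2 (q j') + real K" using near unfolding K_def by linarith
  also have "\<dots> = log 2 (q j' * 2 ^ K)"
    using qj by (simp add: log_mult log_nat_power)
  finally have le: "p i \<le> q j' * 2 ^ K" using pi qj by simp
  have "real (j' - Suc j) * q j' = (\<Sum>l\<in>{Suc j..<j'}. q j')" by simp
  also have "\<dots> \<le> (\<Sum>l\<in>{Suc j..<j'}. q l)"
    by (rule sum_mono) (use q(2) m in auto)
  also have "\<dots> = (\<Sum>l<j'. q l) - (\<Sum>l<Suc j. q l)"
    using sum_diff_nat_ivl[of 0 "Suc j" j' q] less by (simp add: lessThan_atLeast0)
  also have "\<dots> < p i" using meets by simp
  finally have "real (j' - Suc j) * q j' < 2 ^ K * q j'" using le by (simp add: mult.commute)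
  \<comment> \<open>The strictly interior columns number \<open>j' - Suc j\<close>, so the strict
    bound on them becomes the weak bound \<open>j' - j \<le> 2 ^ K\<close>.\<close>
  then have "real (j' - Suc j) < 2 ^ K" using qj by simp
  then have "real (j' - Suc j) < real (2 ^ K)" by simp
  then have "j' - Suc j < 2 ^ K" by (simp only: of_nat_less_iff)
  then show ?thesis unfolding K_def by linarith
qed

text \<open>The coupling of two decreasing sequences by overlapping intervals is monotone, which keeps
  every row and column of its support inside a window of consecutive indices.\<close>

lemma monotone_coupling:
  fixes p q :: "nat \<Rightarrow> real"
  assumes plan: "transport_plan {..<n} p {..<m} q \<mu> \<omega>\<^sub>0"
    and p: "\<forall>i<n. 0 < p i" "(\<Sum>i<n. p i) = 1" "\<forall>i i'. i \<le> i' \<longrightarrow> i' < n \<longrightarrow> p i' \<le> p i"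
    and q: "\<forall>j<m. 0 < q j" "(\<Sum>j<m. q j) = 1" "\<forall>j j'. j \<le> j' \<longrightarrow> j' < m \<longrightarrow> q j' \<le> q j"
  shows "\<exists>\<omega>. transport_plan {..<n} p {..<m} q \<mu> \<omega> \<and>
    (\<forall>i<n. \<forall>j j'. j < j' \<longrightarrow> j' < m \<longrightarrow> \<omega> i j \<noteq> 0 \<longrightarrow> \<omega> i j' \<noteq> 0 \<longrightarrow> j' - j \<le> 2 ^ nat \<lceil>\<mu>\<rceil>) \<and>
    (\<forall>j<m. \<forall>i i'. i < i' \<longrightarrow> i' < n \<longrightarrow> \<omega> i j \<noteq> 0 \<longrightarrow> \<omega> i' j \<noteq> 0 \<longrightarrow> i' - i \<le> 2 ^ nat \<lceil>\<mu>\<rceil>)"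
proof -
  define P where "P i = (\<Sum>l<i. p l)" for i
  define Q where "Q j = (\<Sum>l<j. q l)" for j
  define \<omega> where "\<omega> i j = overlap (P i) (P (Suc i)) (Q j) (Q (Suc j))" for i j
  have P: "P i \<le> P (Suc i)" "0 \<le> P i" "P (Suc i) \<le> 1" if "i < n" for i
    unfolding P_def p(2)[symmetric] by (use p(1) that in \<open>auto intro!: sum_nonneg sum_mono2 simp: less_imp_le simp del: sum.lessThan_Suc\<close>)
  have Q: "Q j \<le> Q (Suc j)" "0 \<le> Q j" "Q (Suc j) \<le> 1" if "j < m" for j
    unfolding Q_def q(2)[symmetric] by (use q(1) that in \<open>auto intro!: sum_nonneg sum_mono2 simp: less_imp_le simp del: sum.lessThan_Suc\<close>)
  have zeroP: "\<omega> i j = 0" if "i < n" "j < m" "P (Suc i) \<le> Q j" for i j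
    unfolding \<omega>_def using P Q that by (intro overlap_eq_0)
  have zeroQ: "\<omega> i j = 0" if "i < n" "j < m" "Q (Suc j) \<le> P i" for i j
    unfolding \<omega>_def using P Q that by (subst overlap_swap) (intro overlap_eq_0)
  have row: "(\<Sum>j<m. \<omega> i j) = p i" if "i < n" for i
    unfolding \<omega>_def Q_def using P[OF that] q(2)
    by (subst sum_overlap) (auto simp: P_def)
  have col: "(\<Sum>i<n. \<omega> i j) = q j" if "j < m" for j
    unfolding \<omega>_def P_def using Q[OF that] p(2)
    by (subst overlap_swap, subst sum_overlap) (auto simp: Q_def)
  \<comment> \<open>The given plan enters here: it forces the intervals of too distant indices to
    meet in at most an endpoint, so the interval coupling respects the same \<mu>.\<close>
  have far: "\<omega> i j = 0" if "i < n" "j < m" "\<bar>log 2 (p i) - log 2 (q j)\<bar> > \<mu>" for i j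
  proof (cases "log 2 (p i) - log 2 (q j) > \<mu>")
    case True
    then have "P (Suc i) \<le> Q j"
      unfolding P_def Q_def by (intro transport_plan_cumulative_le[OF plan p(1,3) q(1,3)] that)
    then show ?thesis using zeroP that by blast
  next
    case False
    then have "log 2 (q j) - log 2 (p i) > \<mu>" using that by linarith
    \<comment> \<open>The opposite deviation is the same argument for the reversed plan, with rows
      and columns exchanged.\<close>
    then have "Q (Suc j) \<le> P i"
      unfolding P_def Q_def
      by (intro transport_plan_cumulative_le[OF plan[folded transport_plan_swap[of "{..<m}"]] q(1,3) p(1,3)] that)
    then show ?thesis using zeroQ that by blast
  qed
  have near: "\<bar>log 2 (p i) - log 2 (q j)\<bar> \<le> \<mu>" if "i < n" "j < m" "\<omega> i j \<noteq> 0" for i j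
    using far that by (meson not_le)
  have meets: "P i < Q (Suc j)" "Q j < P (Suc i)" if "i < n" "j < m" "\<omega> i j \<noteq> 0" for i j
    using zeroP zeroQ that by (meson not_le)+
  have "transport_plan {..<n} p {..<m} q \<mu> \<omega>"
    unfolding transport_plan_def using row col far P Q
    by (auto simp: \<omega>_def intro!: overlap_nonneg)
  moreover have "j' - j \<le> 2 ^ nat \<lceil>\<mu>\<rceil>"
    if "i < n" "j < j'" "j' < m" "\<omega> i j \<noteq> 0" "\<omega> i j' \<noteq> 0" for i j j'
    using monotone_coupling_window[of p i m q j' j \<mu>] p(1) q(1,3) that meets[of i j] meets[of i j']
      near[of i j'] by (auto simp: P_def Q_def simp del: sum.lessThan_Suc)
  moreover have "i' - i \<le> 2 ^ nat \<lceil>\<mu>\<rceil>"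
    if "j < m" "i < i'" "i' < n" "\<omega> i j \<noteq> 0" "\<omega> i' j \<noteq> 0" for i i' j
    using monotone_coupling_window[of q j n p i' i \<mu>] q(1) p(1,3) that meets[of i j] meets[of i' j]
      near[of i' j] by (auto simp: P_def Q_def simp del: sum.lessThan_Suc)
  ultimately show ?thesis by blast
qed

section \<open>Colouring the support and sorting the coefficients\<close>

lemma mod_eq_imp_eq_window:
  fixes a b c D :: nat
  assumes "(c + a) mod D = (c + b) mod D" and "a < b \<Longrightarrow> b - a < D" and "b < a \<Longrightarrow> a - b < D"
  shows "a = b"
proof -
  have *: "x = y" if "(c + x) mod D = (c + y) mod D" "x \<le> y" "y - x < D" for x y :: nat
  proof -
    have "D dvd (c + y) - (c + x)" using that(1,2) by (metis mod_eq_dvd_iff_nat add_le_cancel_left)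
    then show ?thesis using that by (auto dest: dvd_imp_le)
  qed
  show ?thesis
    using *[of a b] *[of b a] assms by (cases a b rule: linorder_cases) auto
qed

text \<open>With \<open>k = nat \<lceil>\<mu>\<rceil>\<close>, a window may hold
  \<open>2 ^ k + 1\<close> indices, one more than \<open>k\<close> qubits can tell apart; hence the
  exponent \<open>Suc k\<close>. Fixing either index of \<open>i + j\<close> leaves a shift of the
  other, so one colour separates entries along rows and along columns.\<close>

lemma colored_coupling:
  fixes p q :: "nat \<Rightarrow> real"
  assumes "transport_plan {..<n} p {..<m} q \<mu> \<omega>\<^sub>0"
    and p: "\<forall>i<n. 0 < p i" "(\<Sum>i<n. p i) = 1" "\<forall>i i'. i \<le> i' \<longrightarrow> i' < n \<longrightarrow> p i' \<le> p i"
    and q: "\<forall>j<m. 0 < q j" "(\<Sum>j<m. q j) = 1" "\<forall>j j'. j \<le> j' \<longrightarrow> j' < m \<longrightarrow> q j' \<le> q j"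
    and D: "D = 2 ^ Suc (nat \<lceil>\<mu>\<rceil>)"
  obtains \<omega> where "\<And>i j. i < n \<Longrightarrow> j < m \<Longrightarrow> 0 \<le> \<omega> i j"
    "\<And>i. i < n \<Longrightarrow> (\<Sum>j<m. \<omega> i j) = p i" "\<And>j. j < m \<Longrightarrow> (\<Sum>i<n. \<omega> i j) = q j"
    "\<And>i j j'. \<lbrakk>i < n; j < m; j' < m; \<omega> i j \<noteq> 0; \<omega> i j' \<noteq> 0; (i + j) mod D = (i + j') mod D\<rbrakk> \<Longrightarrow> j = j'"
    "\<And>i i' j. \<lbrakk>i < n; i' < n; j < m; \<omega> i j \<noteq> 0; \<omega> i' j \<noteq> 0; (i + j) mod D = (i' + j) mod D\<rbrakk> \<Longrightarrow> i = i'"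
proof -
  obtain \<omega> where plan: "transport_plan {..<n} p {..<m} q \<mu> \<omega>"
    and row: "\<And>i j j'. \<lbrakk>i < n; j < j'; j' < m; \<omega> i j \<noteq> 0; \<omega> i j' \<noteq> 0\<rbrakk> \<Longrightarrow> j' - j \<le> 2 ^ nat \<lceil>\<mu>\<rceil>"
    and col: "\<And>i i' j. \<lbrakk>j < m; i < i'; i' < n; \<omega> i j \<noteq> 0; \<omega> i' j \<noteq> 0\<rbrakk> \<Longrightarrow> i' - i \<le> 2 ^ nat \<lceil>\<mu>\<rceil>"
    using monotone_coupling[OF assms(1-7)] by auto
  have less: "x < D" if "x \<le> 2 ^ nat \<lceil>\<mu>\<rceil>" for x :: nat
    unfolding D power_Suc by (rule le_less_trans[OF that]) simp
  show thesis
  proof (rule that)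
    show "j = j'" if "i < n" "j < m" "j' < m" "\<omega> i j \<noteq> 0" "\<omega> i j' \<noteq> 0" "(i + j) mod D = (i + j') mod D" for i j j'
    proof (rule mod_eq_imp_eq_window[OF that(6)])
      show "j' - j < D" if "j < j'"
        using less[OF row[OF \<open>i < n\<close> that]] \<open>j' < m\<close> \<open>\<omega> i j \<noteq> 0\<close> \<open>\<omega> i j' \<noteq> 0\<close> by simp
      show "j - j' < D" if "j' < j"
        using less[OF row[OF \<open>i < n\<close> that]] \<open>j < m\<close> \<open>\<omega> i j \<noteq> 0\<close> \<open>\<omega> i j' \<noteq> 0\<close> by simp
    qed
    show "i = i'" if "i < n" "i' < n" "j < m" "\<omega> i j \<noteq> 0" "\<omega> i' j \<noteq> 0" "(i + j) mod D = (i' + j) mod D" for i i' j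
    proof (rule mod_eq_imp_eq_window)
      show "(j + i) mod D = (j + i') mod D" using that(6) by (simp add: add.commute)
      show "i' - i < D" if "i < i'"
        using less[OF col[OF \<open>j < m\<close> that]] \<open>i' < n\<close> \<open>\<omega> i j \<noteq> 0\<close> \<open>\<omega> i' j \<noteq> 0\<close> by simp
      show "i - i' < D" if "i' < i"
        using less[OF col[OF \<open>j < m\<close> that]] \<open>i < n\<close> \<open>\<omega> i j \<noteq> 0\<close> \<open>\<omega> i' j \<noteq> 0\<close> by simp
    qed
  qed (use plan in \<open>auto simp: transport_plan_def\<close>)
qed

lemma decreasing_enumeration:
  fixes p :: "'a \<Rightarrow> real"
  assumes "finite X"
  obtains g where "bij_betw g {..<card X} X" "\<forall>i i'. i \<le> i' \<longrightarrow> i' < card X \<longrightarrow> p (g i') \<le> p (g i)"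
proof -
  obtain xs where xs: "set xs = X" "distinct xs" using finite_distinct_list[OF assms] by blast
  \<comment> \<open>\<open>sort_key\<close> sorts upwards, so the key is negated.\<close>
  define ys where "ys = sort_key (\<lambda>x. - p x) xs"
  have ys: "set ys = X" "distinct ys" "length ys = card X"
    using xs distinct_card[OF xs(2)] by (auto simp: ys_def)
  have "sorted (map (\<lambda>x. - p x) ys)" by (simp add: ys_def)
  then have "\<forall>i i'. i \<le> i' \<longrightarrow> i' < card X \<longrightarrow> p (ys ! i') \<le> p (ys ! i)"
    using ys(3) by (auto simp: sorted_iff_nth_mono)
  moreover have "bij_betw ((!) ys) {..<card X} X" using bij_betw_nth[OF ys(2)] ys by simp
  ultimately show thesis using that by blast
qed

section \<open>Bipartite states and protocols\<close>

text \<open>The product of \<open>v\<close> with the basis vector \<open>t\<close> of a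
  \<open>D\<close>-dimensional register placed last, in the encoding of \<open>append_A\<close>; the
  case \<open>t = 0\<close> is a fresh ancilla.\<close>

definition tensor_ket :: "nat \<Rightarrow> complex vec \<Rightarrow> nat \<Rightarrow> complex vec" where
  "tensor_ket D v t = vec (dim_vec v * D) (\<lambda>x. if x mod D = t then v $ (x div D) else 0)"

lemma tensor_ket_carrier [simp]: "v \<in> carrier_vec n \<Longrightarrow> tensor_ket D v t \<in> carrier_vec (n * D)"
  by (auto simp: tensor_ket_def)

lemma tensor_ket_index:
  "v \<in> carrier_vec n \<Longrightarrow> x < n * D \<Longrightarrow> tensor_ket D v t $ x = (if x mod D = t then v $ (x div D) else 0)"
  by (auto simp: tensor_ket_def)

text \<open>The indices of residue \<open>t\<close> are \<open>a * D + t\<close>, one for each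
  \<open>a < n\<close>. Inner products with a fixed register state thereby reduce to the first
  factor.\<close>

lemma sum_residue_class:
  fixes F :: "nat \<Rightarrow> 'a::comm_monoid_add"
  assumes t: "t < D"
  shows "(\<Sum>x<n * D. if x mod D = t then F (x div D) else 0) = (\<Sum>a<n. F a)"
proof -
  have lt: "a * D + t < n * D" if "a < n" for a
  proof -
    have "a * D + t < Suc a * D" using t by simp
    also have "\<dots> \<le> n * D" using that by (intro mult_le_mono1) simp
    finally show ?thesis .
  qed
  have "(\<Sum>x<n * D. if x mod D = t then F (x div D) else 0)
      = (\<Sum>x | x < n * D \<and> x mod D = t. F (x div D))"
    by (rule sum.mono_neutral_cong_right) auto
  also have "\<dots> = (\<Sum>a<n. F a)"
    by (rule sum.reindex_bij_witness[of _ "\<lambda>a. a * D + t" "\<lambda>x. x div D"])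
      (use t lt in \<open>auto simp: less_mult_imp_div_less\<close>)
  finally show ?thesis .
qed

lemma cscalar_prod_tensor_ket:
  assumes v: "v \<in> carrier_vec n" and w: "w \<in> carrier_vec n" and t: "t < D"
  shows "tensor_ket D v t \<bullet>c tensor_ket D w t' = (if t = t' then v \<bullet>c w else 0)"
proof -
  have "tensor_ket D v t \<bullet>c tensor_ket D w t'
    = (\<Sum>x<n * D. if x mod D = t then if t = t' then v $ (x div D) * cnj (w $ (x div D)) else 0 else 0)"
    unfolding cscalar_prod_sum[OF tensor_ket_carrier[OF w]]
    by (rule sum.cong) (use v w in \<open>auto simp: tensor_ket_def\<close>)
  also have "\<dots> = (\<Sum>a<n. if t = t' then v $ a * cnj (w $ a) else 0)"
    by (rule sum_residue_class[OF t])
  also have "\<dots> = (if t = t' then v \<bullet>c w else 0)" by (simp add: cscalar_prod_sum[OF w])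
  finally show ?thesis .
qed

lemma orthonormal_family_tensor_ket:
  assumes "orthonormal_family n X e" "0 < D"
  shows "orthonormal_family (n * D) X (\<lambda>i. tensor_ket D (e i) 0)"
  using assms by (auto simp: orthonormal_family_def cscalar_prod_tensor_ket[where n = n])

text \<open>With the length as a parameter, an empty combination is still the zero vector of the
  right dimension.\<close>

definition lin_comb :: "nat \<Rightarrow> 'j set \<Rightarrow> ('j \<Rightarrow> real) \<Rightarrow> ('j \<Rightarrow> complex vec) \<Rightarrow> complex vec" where
  "lin_comb n J \<alpha> h = vec n (\<lambda>x. \<Sum>j\<in>J. of_real (\<alpha> j) * h j $ x)"

lemma cscalar_prod_lin_comb:
  assumes "\<And>j. j \<in> J \<Longrightarrow> g j \<in> carrier_vec n" "\<And>j. j \<in> J \<Longrightarrow> h j \<in> carrier_vec n"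
  shows "lin_comb n J \<alpha> g \<bullet>c lin_comb n J \<beta> h
    = (\<Sum>j\<in>J. \<Sum>j'\<in>J. of_real (\<alpha> j * \<beta> j') * (g j \<bullet>c h j'))"
proof -
  have "lin_comb n J \<alpha> g \<bullet>c lin_comb n J \<beta> h
     = (\<Sum>x<n. \<Sum>j\<in>J. \<Sum>j'\<in>J. of_real (\<alpha> j * \<beta> j') * (g j $ x * cnj (h j' $ x)))"
    by (subst cscalar_prod_sum[where n = n])
      (auto simp: lin_comb_def sum_product mult_ac intro!: sum.cong)
  also have "\<dots> = (\<Sum>j\<in>J. \<Sum>x<n. \<Sum>j'\<in>J. of_real (\<alpha> j * \<beta> j') * (g j $ x * cnj (h j' $ x)))"
    by (rule sum.swap)
  also have "\<dots> = (\<Sum>j\<in>J. \<Sum>j'\<in>J. \<Sum>x<n. of_real (\<alpha> j * \<beta> j') * (g j $ x * cnj (h j' $ x)))"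
    by (rule sum.cong[OF refl], rule sum.swap)
  also have "\<dots> = (\<Sum>j\<in>J. \<Sum>j'\<in>J. of_real (\<alpha> j * \<beta> j') * (g j \<bullet>c h j'))"
    by (intro sum.cong refl) (use assms in \<open>simp add: cscalar_prod_sum[where n = n] sum_distrib_left\<close>)
  finally show ?thesis .
qed

text \<open>Orthonormality of \<open>h\<close> leaves only the terms with equal \<open>j\<close>,
  and those only where the colours agree. For distinct \<open>i\<close> properness then makes a
  coefficient zero; for equal \<open>i\<close> the squares sum to 1. It serves once for Alice and
  once for Bob.\<close>

lemma orthonormal_family_colored:
  assumes h: "orthonormal_family n J h" and J: "finite J"
    and t: "\<And>i j. i \<in> I \<Longrightarrow> j \<in> J \<Longrightarrow> t i j < D"
    and unit: "\<And>i. i \<in> I \<Longrightarrow> (\<Sum>j\<in>J. (\<alpha> i j)\<^sup>2) = 1"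
    and proper: "\<And>i i' j. \<lbrakk>i \<in> I; i' \<in> I; j \<in> J; t i j = t i' j; \<alpha> i j \<noteq> 0; \<alpha> i' j \<noteq> 0\<rbrakk> \<Longrightarrow> i = i'"
  shows "orthonormal_family (n * D) I (\<lambda>i. lin_comb (n * D) J (\<alpha> i) (\<lambda>j. tensor_ket D (h j) (t i j)))"
proof -
  have hc: "h j \<in> carrier_vec n" if "j \<in> J" for j using h that by (auto simp: orthonormal_family_def)
  have "lin_comb (n * D) J (\<alpha> i) (\<lambda>j. tensor_ket D (h j) (t i j))
      \<bullet>c lin_comb (n * D) J (\<alpha> i') (\<lambda>j. tensor_ket D (h j) (t i' j)) = (if i = i' then 1 else 0)"
    (is "?l = _") if i: "i \<in> I" "i' \<in> I" for i i'
  proof -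
    have "?l = (\<Sum>j\<in>J. \<Sum>j'\<in>J. of_real (\<alpha> i j * \<alpha> i' j')
        * (tensor_ket D (h j) (t i j) \<bullet>c tensor_ket D (h j') (t i' j')))"
      using hc by (intro cscalar_prod_lin_comb) auto
    also have "\<dots> = (\<Sum>j\<in>J. \<Sum>j'\<in>J. if j' = j then of_real (if i = i' then (\<alpha> i j)\<^sup>2 else 0) else 0)"
    proof (intro sum.cong refl)
      fix j j' assume j: "j \<in> J" "j' \<in> J"
      have "tensor_ket D (h j) (t i j) \<bullet>c tensor_ket D (h j') (t i' j')
          = (if t i j = t i' j' \<and> j = j' then 1 else 0)"
        using cscalar_prod_tensor_ket[OF hc hc t, of j j' i j "t i' j'"] h i j
        by (auto simp: orthonormal_family_def)
      then show "of_real (\<alpha> i j * \<alpha> i' j') * (tensor_ket D (h j) (t i j) \<bullet>c tensor_ket D (h j') (t i' j'))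
          = (if j' = j then of_real (if i = i' then (\<alpha> i j)\<^sup>2 else 0) else 0 :: complex)"
        using proper[OF i j(1)] by (auto simp: power2_eq_square)
    qed
    also have "\<dots> = of_real (\<Sum>j\<in>J. if i = i' then (\<alpha> i j)\<^sup>2 else 0)"
      using J by simp
    also have "(\<Sum>j\<in>J. if i = i' then (\<alpha> i j)\<^sup>2 else 0) = (if i = i' then 1 else 0)"
      using unit i by simp
    finally show ?thesis by simp
  qed
  then show ?thesis by (auto simp: orthonormal_family_def lin_comb_def)
qed

section \<open>States as sums of product vectors, and their Schmidt forms\<close>

definition bipartite_sum ::
  "nat \<Rightarrow> nat \<Rightarrow> 'i set \<Rightarrow> ('i \<Rightarrow> real) \<Rightarrow> ('i \<Rightarrow> complex vec) \<Rightarrow> ('i \<Rightarrow> complex vec) \<Rightarrow> bstate" where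
  "bipartite_sum m n X c e f = mat m n (\<lambda>(a, b). \<Sum>i\<in>X. of_real (c i) * (e i $ a) * (f i $ b))"

lemma bipartite_sum_dim [simp]:
  "dim_row (bipartite_sum m n X c e f) = m" "dim_col (bipartite_sum m n X c e f) = n"
  by (simp_all add: bipartite_sum_def)

lemma mult_bipartite_sum:
  assumes U: "U \<in> carrier_mat m m" and e: "\<And>i. i \<in> X \<Longrightarrow> e i \<in> carrier_vec m"
    and e': "\<And>i. i \<in> X \<Longrightarrow> U *\<^sub>v e i = e' i"
  shows "U * bipartite_sum m n X c e f = bipartite_sum m n X c e' f"
proof (rule eq_matI)
  fix a b assume "a < dim_row (bipartite_sum m n X c e' f)" "b < dim_col (bipartite_sum m n X c e' f)"
  then have ab: "a < m" "b < n" by auto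
  have "(U * bipartite_sum m n X c e f) $$ (a, b)
      = (\<Sum>k<m. \<Sum>i\<in>X. of_real (c i) * (U $$ (a, k) * e i $ k) * f i $ b)"
    using U ab by (auto simp: scalar_prod_def lessThan_atLeast0 bipartite_sum_def sum_distrib_left
        intro!: sum.cong)
  also have "\<dots> = (\<Sum>i\<in>X. \<Sum>k<m. of_real (c i) * (U $$ (a, k) * e i $ k) * f i $ b)"
    by (rule sum.swap)
  also have "\<dots> = (\<Sum>i\<in>X. of_real (c i) * e' i $ a * f i $ b)"
  proof (rule sum.cong[OF refl])
    fix i assume i: "i \<in> X"
    have "e' i $ a = (\<Sum>k<m. U $$ (a, k) * e i $ k)"
      using U ab e[OF i] by (auto simp: e'[OF i, symmetric] scalar_prod_def lessThan_atLeast0)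
    then show "(\<Sum>k<m. of_real (c i) * (U $$ (a, k) * e i $ k) * f i $ b)
      = of_real (c i) * e' i $ a * f i $ b"
      by (simp add: sum_distrib_left sum_distrib_right)
  qed
  finally show "(U * bipartite_sum m n X c e f) $$ (a, b) = bipartite_sum m n X c e' f $$ (a, b)"
    using ab by (simp add: bipartite_sum_def)
qed (use U in auto)

lemma transpose_bipartite_sum:
  "transpose_mat (bipartite_sum m n X c e f) = bipartite_sum n m X c f e"
  by (rule eq_matI) (auto simp: bipartite_sum_def mult_ac)

text \<open>Transposition exchanges the two parties, which reduces Bob's unitary to
  \<open>mult_bipartite_sum\<close>.\<close>

lemma bipartite_sum_mult_transpose:
  assumes V: "V \<in> carrier_mat n n" and f: "\<And>i. i \<in> X \<Longrightarrow> f i \<in> carrier_vec n"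
    and f': "\<And>i. i \<in> X \<Longrightarrow> V *\<^sub>v f i = f' i"
  shows "bipartite_sum m n X c e f * transpose_mat V = bipartite_sum m n X c e f'"
proof -
  have "transpose_mat (bipartite_sum m n X c e f * transpose_mat V) = V * bipartite_sum n m X c f e"
    by (subst transpose_mult[of _ m n _ n]) (use V in \<open>auto simp: transpose_bipartite_sum\<close>)
  also have "\<dots> = bipartite_sum n m X c f' e"
    by (rule mult_bipartite_sum[OF V f f'])
  finally show ?thesis
    by (metis transpose_bipartite_sum transpose_transpose)
qed

lemma schmidt_form_iff:
  "schmidt_form \<psi> X p \<longleftrightarrow> finite X \<and> (\<forall>i\<in>X. 0 < p i) \<and> (\<Sum>i\<in>X. p i) = 1 \<and>
     (\<exists>e f. orthonormal_family (dim_row \<psi>) X e \<and> orthonormal_family (dim_col \<psi>) X f \<and>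
        \<psi> = bipartite_sum (dim_row \<psi>) (dim_col \<psi>) X (\<lambda>i. sqrt (p i)) e f)"
  by (simp add: schmidt_form_def bipartite_sum_def)

lemma append_A_bipartite_sum:
  assumes "\<And>i. i \<in> X \<Longrightarrow> e i \<in> carrier_vec m"
  shows "append_A k (bipartite_sum m n X c e f)
    = bipartite_sum (m * k) n X c (\<lambda>i. tensor_ket k (e i) 0) f"
  by (rule eq_matI)
    (use assms in \<open>auto simp: append_A_def bipartite_sum_def tensor_ket_index[where n = m] less_mult_imp_div_less
      intro!: sum.cong sum.neutral\<close>)

lemma append_B_bipartite_sum:
  assumes "\<And>i. i \<in> X \<Longrightarrow> f i \<in> carrier_vec n"
  shows "append_B k (bipartite_sum m n X c e f)
    = bipartite_sum m (n * k) X c e (\<lambda>i. tensor_ket k (f i) 0)"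
  by (rule eq_matI)
    (use assms in \<open>auto simp: append_B_def bipartite_sum_def tensor_ket_index[where n = n] less_mult_imp_div_less
      intro!: sum.cong sum.neutral\<close>)

text \<open>The ancilla tensors Alice's Schmidt vectors with a fixed unit vector, so they stay
  orthonormal while the coefficients are untouched.\<close>

lemma schmidt_form_append_A:
  assumes "schmidt_form \<psi> X p" "0 < k"
  shows "schmidt_form (append_A k \<psi>) X p"
proof -
  obtain e f where ef: "orthonormal_family (dim_row \<psi>) X e" "orthonormal_family (dim_col \<psi>) X f"
    and eq: "\<psi> = bipartite_sum (dim_row \<psi>) (dim_col \<psi>) X (\<lambda>i. sqrt (p i)) e f"
    using assms(1) by (auto simp: schmidt_form_iff)
  have dim: "dim_row (append_A k \<psi>) = dim_row \<psi> * k" "dim_col (append_A k \<psi>) = dim_col \<psi>"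
    by (simp_all add: append_A_def)
  have "append_A k \<psi> = bipartite_sum (dim_row \<psi> * k) (dim_col \<psi>) X (\<lambda>i. sqrt (p i)) (\<lambda>i. tensor_ket k (e i) 0) f"
    by (subst eq, rule append_A_bipartite_sum) (use ef in \<open>auto simp: orthonormal_family_def\<close>)
  then show ?thesis
    unfolding schmidt_form_iff dim
    using orthonormal_family_tensor_ket[OF ef(1) assms(2)] ef(2) assms(1)
    by (auto simp: schmidt_form_def)
qed

lemma schmidt_form_append_B:
  assumes "schmidt_form \<psi> X p" "0 < k"
  shows "schmidt_form (append_B k \<psi>) X p"
proof -
  obtain e f where ef: "orthonormal_family (dim_row \<psi>) X e" "orthonormal_family (dim_col \<psi>) X f"
    and eq: "\<psi> = bipartite_sum (dim_row \<psi>) (dim_col \<psi>) X (\<lambda>i. sqrt (p i)) e f"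
    using assms(1) by (auto simp: schmidt_form_iff)
  have dim: "dim_row (append_B k \<psi>) = dim_row \<psi>" "dim_col (append_B k \<psi>) = dim_col \<psi> * k"
    by (simp_all add: append_B_def)
  have "append_B k \<psi> = bipartite_sum (dim_row \<psi>) (dim_col \<psi> * k) X (\<lambda>i. sqrt (p i)) e (\<lambda>i. tensor_ket k (f i) 0)"
    by (subst eq, rule append_B_bipartite_sum) (use ef in \<open>auto simp: orthonormal_family_def\<close>)
  then show ?thesis
    unfolding schmidt_form_iff dim
    using orthonormal_family_tensor_ket[OF ef(2) assms(2)] ef(1) assms(1)
    by (auto simp: schmidt_form_def)
qed

text \<open>Allows the coefficients to be numbered in decreasing order, as the coupling
  requires.\<close>

lemma schmidt_form_reindex:
  assumes "schmidt_form \<psi> X p" and g: "bij_betw g N X"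
  shows "schmidt_form \<psi> N (p \<circ> g)"
proof -
  obtain e f where ef: "orthonormal_family (dim_row \<psi>) X e" "orthonormal_family (dim_col \<psi>) X f"
    and eq: "\<psi> = bipartite_sum (dim_row \<psi>) (dim_col \<psi>) X (\<lambda>i. sqrt (p i)) e f"
    using assms(1) by (auto simp: schmidt_form_iff)
  have gN: "g i \<in> X" if "i \<in> N" for i using g that by (auto simp: bij_betw_def)
  have orth: "orthonormal_family n N (h \<circ> g)" if "orthonormal_family n X h" for n h
    using that gN g by (auto simp: orthonormal_family_def bij_betw_def inj_on_def)
  have "bipartite_sum (dim_row \<psi>) (dim_col \<psi>) X (\<lambda>i. sqrt (p i)) e f
      = bipartite_sum (dim_row \<psi>) (dim_col \<psi>) N (\<lambda>i. sqrt ((p \<circ> g) i)) (e \<circ> g) (f \<circ> g)"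
    unfolding bipartite_sum_def by (simp flip: sum.reindex_bij_betw[OF g])
  moreover have "finite N" using assms(1) bij_betw_finite[OF g] by (simp add: schmidt_form_def)
  moreover have "(\<Sum>i\<in>N. (p \<circ> g) i) = 1"
    using assms(1) sum.reindex_bij_betw[OF g, of p] by (simp add: schmidt_form_def)
  ultimately show ?thesis
    using assms(1) gN orth[OF ef(1)] orth[OF ef(2)] eq unfolding schmidt_form_iff by fastforce
qed

section \<open>Executions and the transfer of a register\<close>

lemma executes_append:
  "executes M \<psi> \<phi> \<Longrightarrow> executes N \<phi> \<theta> \<Longrightarrow> executes (M @ N) \<psi> \<theta>"
  by (induction rule: executes.induct) (auto intro: executes.intros)

lemma executes_single: "move_step s \<psi> \<phi> \<Longrightarrow> executes [s] \<psi> \<phi>"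
  by (auto intro: executes.intros)

text \<open>The qubits leave Alice's register one at a time, so they arrive in a different order, which
  the injection \<open>\<tau>\<close> records.\<close>

lemma executes_send_AB_many:
  "\<exists>\<tau>. inj_on \<tau> {..<2 ^ c} \<and> \<tau> ` {..<2 ^ c} \<subseteq> {..<2 ^ c} \<and>
     (\<forall>m n \<psi>. dim_row \<psi> = m * 2 ^ c \<longrightarrow> dim_col \<psi> = n \<longrightarrow>
       executes (replicate c Send_AB) \<psi>
         (mat m (n * 2 ^ c) (\<lambda>(a, b). \<psi> $$ (a * 2 ^ c + \<tau> (b mod 2 ^ c), b div 2 ^ c))))"
proof (induction c)
  case 0
  have "executes [] \<psi> (mat (dim_row \<psi>) (dim_col \<psi>) (\<lambda>(a, b). \<psi> $$ (a, b)))" for \<psi> :: bstate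
  proof -
    have "mat (dim_row \<psi>) (dim_col \<psi>) (\<lambda>(a, b). \<psi> $$ (a, b)) = \<psi>" by (rule eq_matI) auto
    then show ?thesis by (simp add: executes_Nil)
  qed
  then show ?case by (intro exI[of _ "\<lambda>_. 0"]) (auto simp: inj_on_def)
next
  case (Suc c)
  then obtain \<tau> :: "nat \<Rightarrow> nat" where inj: "inj_on \<tau> {..<2 ^ c}" and range: "\<tau> ` {..<2 ^ c} \<subseteq> {..<2 ^ c}"
    and ex: "\<And>m n \<psi>. dim_row \<psi> = m * 2 ^ c \<Longrightarrow> dim_col \<psi> = n \<Longrightarrow>
       executes (replicate c Send_AB) \<psi>
         (mat m (n * 2 ^ c) (\<lambda>(a, b). \<psi> $$ (a * 2 ^ c + \<tau> (b mod 2 ^ c), b div 2 ^ c)))"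
    by blast
  \<comment> \<open>\<open>send_AB\<close> turns Alice's lowest bit into Bob's lowest bit, and the
    \<open>c\<close> later sends push it up to weight \<open>2 ^ c\<close>. So the top bit
    \<open>b div 2 ^ c\<close> of Bob's register was Alice's lowest one, and \<tau> arranges the
    others.\<close>
  define \<sigma> where "\<sigma> b = 2 * \<tau> (b mod 2 ^ c) + b div 2 ^ c" for b :: nat
  have div: "b div 2 ^ c < 2" if "b < 2 ^ Suc c" for b :: nat
    using that by (simp add: less_mult_imp_div_less)
  have mod: "\<tau> (b mod 2 ^ c) < 2 ^ c" for b :: nat
    using range by (auto simp: image_subset_iff)
  have "inj_on \<sigma> {..<2 ^ Suc c}"
  proof (rule inj_onI)
    fix x y assume xy: "x \<in> {..<2 ^ Suc c}" "y \<in> {..<2 ^ Suc c}" "\<sigma> x = \<sigma> y"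
    have "x div 2 ^ c < 2" "y div 2 ^ c < 2" using div xy by auto
    moreover have "k = k' \<and> d = d'" if "d < 2" "d' < 2" "2 * k + d = 2 * k' + d'" for k k' d d' :: nat
      using that by presburger
    ultimately have "\<tau> (x mod 2 ^ c) = \<tau> (y mod 2 ^ c)" and d: "x div 2 ^ c = y div 2 ^ c"
      using xy(3) unfolding \<sigma>_def by blast+
    then have "x mod 2 ^ c = y mod 2 ^ c" using inj by (auto dest!: inj_onD)
    with d show "x = y" by (metis div_mult_mod_eq)
  qed
  moreover have "\<sigma> b < 2 ^ Suc c" if "b < 2 ^ Suc c" for b
    using div[OF that] mod[of b] unfolding \<sigma>_def power_Suc by linarith
  moreover have "executes (replicate (Suc c) Send_AB) \<psi>
         (mat m (n * 2 ^ Suc c) (\<lambda>(a, b). \<psi> $$ (a * 2 ^ Suc c + \<sigma> (b mod 2 ^ Suc c), b div 2 ^ Suc c)))"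
    if dim: "dim_row \<psi> = m * 2 ^ Suc c" "dim_col \<psi> = n" for m n and \<psi> :: bstate
  proof -
    \<comment> \<open>The induction hypothesis applies after the first send, when Bob's dimension is
      already \<open>n * 2\<close>.\<close>
    have "executes (replicate c Send_AB) (send_AB \<psi>) (mat m ((n * 2) * 2 ^ c)
        (\<lambda>(a, b). send_AB \<psi> $$ (a * 2 ^ c + \<tau> (b mod 2 ^ c), b div 2 ^ c)))"
      by (rule ex) (use dim in \<open>auto simp: send_AB_def\<close>)
    also have "mat m ((n * 2) * 2 ^ c) (\<lambda>(a, b). send_AB \<psi> $$ (a * 2 ^ c + \<tau> (b mod 2 ^ c), b div 2 ^ c))
      = mat m (n * 2 ^ Suc c) (\<lambda>(a, b). \<psi> $$ (a * 2 ^ Suc c + \<sigma> (b mod 2 ^ Suc c), b div 2 ^ Suc c))"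
    proof (rule eq_matI)
      fix a b
      assume "a < dim_row (mat m (n * 2 ^ Suc c) (\<lambda>(a, b). \<psi> $$ (a * 2 ^ Suc c + \<sigma> (b mod 2 ^ Suc c), b div 2 ^ Suc c)))"
        "b < dim_col (mat m (n * 2 ^ Suc c) (\<lambda>(a, b). \<psi> $$ (a * 2 ^ Suc c + \<sigma> (b mod 2 ^ Suc c), b div 2 ^ Suc c)))"
      then have ab: "a < m" "b < n * 2 ^ Suc c" by auto
      have "a * 2 ^ c + \<tau> (b mod 2 ^ c) < Suc a * 2 ^ c" using mod[of b] by simp
      also have "\<dots> \<le> m * 2 ^ c" using ab by (intro mult_le_mono1) simp
      finally have row: "a * 2 ^ c + \<tau> (b mod 2 ^ c) < m * 2 ^ c" .
      have col: "b div 2 ^ c < n * 2" using ab by (simp add: less_mult_imp_div_less mult.commute mult.left_commute)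
      \<comment> \<open>Bob's low \<open>Suc c\<close> bits split into the qubit sent first and the
        \<open>c\<close> qubits sent after it.\<close>
      have "b mod 2 ^ Suc c = 2 ^ c * (b div 2 ^ c mod 2) + b mod 2 ^ c"
        using mod_mult2_eq[of b "2 ^ c" 2] by (simp add: mult.commute)
      then have "b mod 2 ^ Suc c div 2 ^ c = b div 2 ^ c mod 2" "b mod 2 ^ Suc c mod 2 ^ c = b mod 2 ^ c"
        by simp_all
      then have "\<sigma> (b mod 2 ^ Suc c) = 2 * \<tau> (b mod 2 ^ c) + b div 2 ^ c mod 2"
        by (simp add: \<sigma>_def)
      then have idx: "2 * (a * 2 ^ c + \<tau> (b mod 2 ^ c)) + b div 2 ^ c mod 2 = a * 2 ^ Suc c + \<sigma> (b mod 2 ^ Suc c)"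
        by (simp add: algebra_simps)
      have dv: "b div 2 ^ c div 2 = b div 2 ^ Suc c"
        using div_mult2_eq[of b "2 ^ c" 2] by (simp add: mult.commute)
      have "send_AB \<psi> $$ (a * 2 ^ c + \<tau> (b mod 2 ^ c), b div 2 ^ c)
        = \<psi> $$ (2 * (a * 2 ^ c + \<tau> (b mod 2 ^ c)) + b div 2 ^ c mod 2, b div 2 ^ c div 2)"
        unfolding send_AB_def using row col dim by simp
      also have "\<dots> = \<psi> $$ (a * 2 ^ Suc c + \<sigma> (b mod 2 ^ Suc c), b div 2 ^ Suc c)"
        unfolding idx dv ..
      finally show "mat m ((n * 2) * 2 ^ c) (\<lambda>(a, b). send_AB \<psi> $$ (a * 2 ^ c + \<tau> (b mod 2 ^ c), b div 2 ^ c)) $$ (a, b)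
        = mat m (n * 2 ^ Suc c) (\<lambda>(a, b). \<psi> $$ (a * 2 ^ Suc c + \<sigma> (b mod 2 ^ Suc c), b div 2 ^ Suc c)) $$ (a, b)"
        using ab by (simp add: mult.assoc)
    qed (auto simp: mult.assoc)
    finally show ?thesis
      using dim by (auto intro!: executes_Cons move_step.send_AB)
  qed
  ultimately show ?case by (intro exI[of _ \<sigma>]) (auto simp: image_subset_iff)
qed

text \<open>Coefficients with sum 1 need a nonempty index set, hence a unit vector on each side. The
  protocol takes its ancilla sizes from these dimensions, and such sizes must be positive.\<close>

lemma schmidt_form_dim_pos:
  assumes "schmidt_form \<psi> X p"
  shows "0 < dim_row \<psi>" "0 < dim_col \<psi>"
proof -
  obtain i where i: "i \<in> X" using assms by (fastforce simp: schmidt_form_def)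
  have "0 < n" if "orthonormal_family n X h" for n h
  proof -
    have h: "h i \<in> carrier_vec n" "h i \<bullet>c h i = 1" using that i by (auto simp: orthonormal_family_def)
    then have "(\<Sum>k<n. h i $ k * cnj (h i $ k)) = 1" using cscalar_prod_sum[OF h(1), of "h i"] by simp
    then show ?thesis by (cases n) auto
  qed
  then show "0 < dim_row \<psi>" "0 < dim_col \<psi>" using assms by (auto simp: schmidt_form_def)
qed

text \<open>Consider the sum over \<open>i\<close> and \<open>j\<close> of
  \<open>sqrt (\<omega> i j)\<close> times \<open>e' j\<close>, \<open>f i\<close> and a register
  holding the colour \<open>t i j\<close>. Collected by \<open>i\<close>, with the register at
  Alice, it is \<chi> up to a unitary of Alice; collected by \<open>j\<close>, with the register at
  Bob, it is \<upsilon> up to a unitary of Bob. Only the passage of the register costs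
  qubits.\<close>

lemma colored_coupling_conversion:
  assumes \<chi>: "schmidt_form \<chi> X p" and \<upsilon>: "schmidt_form \<upsilon> Y q"
    and dim: "dim_row \<chi> = dim_row \<upsilon> * 2 ^ c" "dim_col \<upsilon> = dim_col \<chi> * 2 ^ c"
    and \<omega>: "\<And>i j. i \<in> X \<Longrightarrow> j \<in> Y \<Longrightarrow> 0 \<le> \<omega> i j"
      "\<And>i. i \<in> X \<Longrightarrow> (\<Sum>j\<in>Y. \<omega> i j) = p i" "\<And>j. j \<in> Y \<Longrightarrow> (\<Sum>i\<in>X. \<omega> i j) = q j"
    and t: "\<And>i j. i \<in> X \<Longrightarrow> j \<in> Y \<Longrightarrow> t i j < (2::nat) ^ c"
    and row: "\<And>i j j'. \<lbrakk>i \<in> X; j \<in> Y; j' \<in> Y; \<omega> i j \<noteq> 0; \<omega> i j' \<noteq> 0; t i j = t i j'\<rbrakk> \<Longrightarrow> j = j'"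
    and col: "\<And>i i' j. \<lbrakk>i \<in> X; i' \<in> X; j \<in> Y; \<omega> i j \<noteq> 0; \<omega> i' j \<noteq> 0; t i j = t i' j\<rbrakk> \<Longrightarrow> i = i'"
  shows "\<exists>M. executes M \<chi> \<upsilon> \<and> qubit_cost M = c"
proof -
  define D :: nat where "D = 2 ^ c"
  define r where "r = dim_row \<upsilon>"
  define s where "s = dim_col \<chi>"
  have D: "0 < D" by (simp add: D_def)
  have fin: "finite X" "finite Y" and p: "\<And>i. i \<in> X \<Longrightarrow> 0 < p i" and q: "\<And>j. j \<in> Y \<Longrightarrow> 0 < q j"
    using \<chi> \<upsilon> by (auto simp: schmidt_form_def)
  have rD: "r * D = dim_row \<chi>" and sD: "s * D = dim_col \<upsilon>"
    using dim by (simp_all add: r_def s_def D_def)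
  obtain e f where e: "orthonormal_family (r * D) X e" and f: "orthonormal_family s X f"
    and \<chi>_eq: "\<chi> = bipartite_sum (r * D) s X (\<lambda>i. sqrt (p i)) e f"
    using \<chi> unfolding schmidt_form_iff rD s_def by blast
  obtain e' f' where e': "orthonormal_family r Y e'" and f': "orthonormal_family (s * D) Y f'"
    and \<upsilon>_eq: "\<upsilon> = bipartite_sum r (s * D) Y (\<lambda>j. sqrt (q j)) e' f'"
    using \<upsilon> unfolding schmidt_form_iff sD r_def by blast
  obtain \<tau> where inj: "inj_on \<tau> {..<D}" and \<tau>: "\<tau> ` {..<D} \<subseteq> {..<D}"
    and send: "\<And>m n \<psi>. dim_row \<psi> = m * D \<Longrightarrow> dim_col \<psi> = n \<Longrightarrow>
       executes (replicate c Send_AB) \<psi>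
         (mat m (n * D) (\<lambda>(a, b). \<psi> $$ (a * D + \<tau> (b mod D), b div D)))"
    using executes_send_AB_many[of c] unfolding D_def by blast
  \<comment> \<open>Alice writes \<open>\<tau> (t i j)\<close> rather than \<open>t i j\<close>, so
    that the reordering in transit delivers the colour \<open>t i j\<close> to Bob.\<close>
  define \<phi> where "\<phi> i = lin_comb (r * D) Y (\<lambda>j. sqrt (\<omega> i j / p i)) (\<lambda>j. tensor_ket D (e' j) (\<tau> (t i j)))" for i
  define g where "g j = lin_comb (s * D) X (\<lambda>i. sqrt (\<omega> i j / q j)) (\<lambda>i. tensor_ket D (f i) (t i j))" for j
  have \<phi>: "orthonormal_family (r * D) X \<phi>"
    unfolding \<phi>_def
  proof (rule orthonormal_family_colored[OF e' fin(2)])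
    show "\<tau> (t i j) < D" if "i \<in> X" "j \<in> Y" for i j
      using t[OF that] \<tau> by (auto simp: D_def image_subset_iff)
    show "(\<Sum>j\<in>Y. (sqrt (\<omega> i j / p i))\<^sup>2) = 1" if i: "i \<in> X" for i
    proof -
      have "(\<Sum>j\<in>Y. (sqrt (\<omega> i j / p i))\<^sup>2) = (\<Sum>j\<in>Y. \<omega> i j / p i)"
        by (rule sum.cong) (use \<omega>(1)[OF i] p[OF i] in auto)
      also have "\<dots> = 1" using \<omega>(2)[OF i] p[OF i] by (simp flip: sum_divide_distrib)
      finally show ?thesis .
    qed
    \<comment> \<open>Vectors of different rows can overlap only in a common column, so properness
      along columns is what matters here, after cancelling the injective \<tau>. For Bob's vectors
      the roles are exchanged.\<close>
    show "i = i'" if "i \<in> X" "i' \<in> X" "j \<in> Y" "\<tau> (t i j) = \<tau> (t i' j)"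
      "sqrt (\<omega> i j / p i) \<noteq> 0" "sqrt (\<omega> i' j / p i') \<noteq> 0" for i i' j
      using that t inj by (intro col[of i i' j]) (auto simp: D_def dest: inj_onD)
  qed
  have g: "orthonormal_family (s * D) Y g"
    unfolding g_def
  proof (rule orthonormal_family_colored[OF f fin(1)])
    show "t i j < D" if "j \<in> Y" "i \<in> X" for i j
      using t that by (simp add: D_def)
    show "(\<Sum>i\<in>X. (sqrt (\<omega> i j / q j))\<^sup>2) = 1" if j: "j \<in> Y" for j
    proof -
      have "(\<Sum>i\<in>X. (sqrt (\<omega> i j / q j))\<^sup>2) = (\<Sum>i\<in>X. \<omega> i j / q j)"
        by (rule sum.cong) (use \<omega>(1)[OF _ j] q[OF j] in auto)
      also have "\<dots> = 1" using \<omega>(3)[OF j] q[OF j] by (simp flip: sum_divide_distrib)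
      finally show ?thesis .
    qed
    show "j = j'" if "j \<in> Y" "j' \<in> Y" "i \<in> X" "t i j = t i j'"
      "sqrt (\<omega> i j / q j) \<noteq> 0" "sqrt (\<omega> i j' / q j') \<noteq> 0" for j j' i
      using that by (intro row[of i j j']) auto
  qed
  obtain U where U: "unitary_mat (r * D) U" "\<And>i. i \<in> X \<Longrightarrow> U *\<^sub>v e i = \<phi> i"
    using unitary_between_orthonormal_families[OF fin(1) e \<phi>] by blast
  obtain V where V: "unitary_mat (s * D) V" "\<And>j. j \<in> Y \<Longrightarrow> V *\<^sub>v g j = f' j"
    using unitary_between_orthonormal_families[OF fin(2) g f'] by blast
  let ?\<psi> = "bipartite_sum (r * D) s X (\<lambda>i. sqrt (p i)) \<phi> f"
  let ?\<theta> = "bipartite_sum r (s * D) Y (\<lambda>j. sqrt (q j)) e' g"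
  have "U * \<chi> = ?\<psi>"
    unfolding \<chi>_eq
    by (rule mult_bipartite_sum) (use U e in \<open>auto simp: unitary_mat_def orthonormal_family_def\<close>)
  then have "move_step (Unitary_A U) \<chi> ?\<psi>"
    using move_step.unitary_A[of \<chi> U] U(1) by (simp add: \<chi>_eq)
  then have 1: "executes [Unitary_A U] \<chi> ?\<psi>" by (rule executes_single)
  have "mat r (s * D) (\<lambda>(a, b). ?\<psi> $$ (a * D + \<tau> (b mod D), b div D)) = ?\<theta>" (is "?l = _")
  proof (rule eq_matI)
    fix a b assume "a < dim_row ?\<theta>" "b < dim_col ?\<theta>"
    then have ab: "a < r" "b < s * D" by auto
    have bD: "b mod D < D" "b div D < s" using D ab by (auto simp: less_mult_imp_div_less)
    have \<tau>b: "\<tau> (b mod D) < D" using \<tau> bD by auto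
    have "a * D + \<tau> (b mod D) < Suc a * D" using \<tau>b by simp
    also have "\<dots> \<le> r * D" using ab by (intro mult_le_mono1) simp
    finally have idx: "a * D + \<tau> (b mod D) < r * D" .
    have \<phi>_idx: "\<phi> i $ (a * D + \<tau> (b mod D))
        = (\<Sum>j\<in>Y. of_real (sqrt (\<omega> i j / p i)) * (if b mod D = t i j then e' j $ a else 0))"
      if i: "i \<in> X" for i
    proof -
      have "tensor_ket D (e' j) (\<tau> (t i j)) $ (a * D + \<tau> (b mod D)) = (if b mod D = t i j then e' j $ a else 0)"
        if j: "j \<in> Y" for j
      proof -
        have "(\<tau> (b mod D) = \<tau> (t i j)) = (b mod D = t i j)"
          using inj_on_eq_iff[OF inj, of "b mod D" "t i j"] bD t[OF i j] by (simp add: D_def)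
        moreover have "(a * D + \<tau> (b mod D)) mod D = \<tau> (b mod D)" "(a * D + \<tau> (b mod D)) div D = a"
          using \<tau>b by simp_all
        moreover have "e' j \<in> carrier_vec r" using e' j by (auto simp: orthonormal_family_def)
        ultimately show ?thesis by (simp only: tensor_ket_index[OF _ idx])
      qed
      then show ?thesis using idx by (simp add: \<phi>_def lin_comb_def)
    qed
    have g_idx: "g j $ b = (\<Sum>i\<in>X. of_real (sqrt (\<omega> i j / q j)) * (if b mod D = t i j then f i $ (b div D) else 0))"
      if j: "j \<in> Y" for j
    proof -
      have "tensor_ket D (f i) (t i j) $ b = (if b mod D = t i j then f i $ (b div D) else 0)" if "i \<in> X" for i
        by (rule tensor_ket_index[where n = s]) (use f that ab in \<open>auto simp: orthonormal_family_def\<close>)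
      then show ?thesis using ab by (simp add: g_def lin_comb_def)
    qed
    \<comment> \<open>The normalisations by \<open>p i\<close> and \<open>q j\<close> cancel to the
      amplitude \<open>sqrt (\<omega> i j)\<close>, which leaves one summand common to both
      groupings.\<close>
    let ?F = "\<lambda>i j. of_real (sqrt (\<omega> i j)) * (if b mod D = t i j then e' j $ a * f i $ (b div D) else 0) :: complex"
    have "?l $$ (a, b) = (\<Sum>i\<in>X. of_real (sqrt (p i)) * \<phi> i $ (a * D + \<tau> (b mod D)) * f i $ (b div D))"
      using ab idx bD by (simp add: bipartite_sum_def)
    also have "\<dots> = (\<Sum>i\<in>X. \<Sum>j\<in>Y. ?F i j)"
    proof (rule sum.cong[OF refl])
      fix i assume i: "i \<in> X"
      have "sqrt (\<omega> i j) = sqrt (p i) * sqrt (\<omega> i j / p i)" for j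
        using p[OF i] by (simp flip: real_sqrt_mult)
      then show "of_real (sqrt (p i)) * \<phi> i $ (a * D + \<tau> (b mod D)) * f i $ (b div D) = (\<Sum>j\<in>Y. ?F i j)"
        unfolding \<phi>_idx[OF i] sum_distrib_left sum_distrib_right by (intro sum.cong) auto
    qed
    also have "\<dots> = (\<Sum>j\<in>Y. \<Sum>i\<in>X. ?F i j)" by (rule sum.swap)
    also have "\<dots> = (\<Sum>j\<in>Y. of_real (sqrt (q j)) * e' j $ a * g j $ b)"
    proof (rule sum.cong[OF refl])
      fix j assume j: "j \<in> Y"
      have "sqrt (\<omega> i j) = sqrt (q j) * sqrt (\<omega> i j / q j)" for i
        using q[OF j] by (simp flip: real_sqrt_mult)
      then show "(\<Sum>i\<in>X. ?F i j) = of_real (sqrt (q j)) * e' j $ a * g j $ b"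
        unfolding g_idx[OF j] sum_distrib_left by (intro sum.cong) auto
    qed
    also have "\<dots> = ?\<theta> $$ (a, b)" using ab by (simp add: bipartite_sum_def)
    finally show "?l $$ (a, b) = ?\<theta> $$ (a, b)" .
  qed auto
  then have 2: "executes (replicate c Send_AB) ?\<psi> ?\<theta>" using send[of ?\<psi> r s] by simp
  have "?\<theta> * transpose_mat V = \<upsilon>"
    unfolding \<upsilon>_eq
    by (rule bipartite_sum_mult_transpose) (use V g in \<open>auto simp: unitary_mat_def orthonormal_family_def\<close>)
  then have "move_step (Unitary_B V) ?\<theta> \<upsilon>"
    using move_step.unitary_B[of ?\<theta> V] V(1) by simp
  then have 3: "executes [Unitary_B V] ?\<theta> \<upsilon>" by (rule executes_single)
  have "executes ([Unitary_A U] @ replicate c Send_AB @ [Unitary_B V]) \<chi> \<upsilon>"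
    by (rule executes_append[OF 1 executes_append[OF 2 3]])
  then show ?thesis by (auto simp: qubit_cost_def intro!: exI)
qed

section \<open>Sorting, padding and counting qubits\<close>

lemma transport_plan_reindex:
  assumes "transport_plan X p Y q \<mu> \<omega>" and g: "bij_betw g N X" and h: "bij_betw h K Y"
  shows "transport_plan N (p \<circ> g) K (q \<circ> h) \<mu> (\<lambda>i j. \<omega> (g i) (h j))"
proof -
  have "g i \<in> X" if "i \<in> N" for i using g that by (auto simp: bij_betw_def)
  moreover have "h j \<in> Y" if "j \<in> K" for j using h that by (auto simp: bij_betw_def)
  ultimately show ?thesis
    using assms(1) sum.reindex_bij_betw[OF h, of "\<lambda>j. \<omega> (g i) j" for i] sum.reindex_bij_betw[OF g, of "\<lambda>i. \<omega> i (h j)" for j]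
    by (auto simp: transport_plan_def)
qed

theorem theorem3:
  fixes \<chi> \<upsilon> :: "complex mat"
    and X :: "'x set" and p :: "'x \<Rightarrow> real"
    and Y :: "'y set" and q :: "'y \<Rightarrow> real"
  assumes "schmidt_form \<chi> X p"
    and "schmidt_form \<upsilon> Y q"
  shows "\<exists>M. prepares M \<chi> \<upsilon> \<and> int (qubit_cost M) \<le> 4 * \<lceil>d_infty X p Y q\<rceil> + 8"
proof -
  define \<mu> where "\<mu> = d_infty X p Y q"
  \<comment> \<open>The number of qubits that carry one of \<open>D\<close> colours.\<close>
  define c where "c = Suc (nat \<lceil>\<mu>\<rceil>)"
  define D :: nat where "D = 2 ^ c"
  have X: "finite X" "\<forall>i\<in>X. 0 < p i" "(\<Sum>i\<in>X. p i) = 1"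
    and Y: "finite Y" "\<forall>j\<in>Y. 0 < q j" "(\<Sum>j\<in>Y. q j) = 1"
    using assms by (auto simp: schmidt_form_def)
  have \<mu>: "0 \<le> \<mu>" and "\<exists>\<omega>. transport_plan X p Y q \<mu> \<omega>"
    unfolding \<mu>_def using d_infty_minimum(1,2)[OF X(1) Y(1) X(2) Y(2) X(3) Y(3)] by auto
  then obtain \<omega>\<^sub>0 where plan: "transport_plan X p Y q \<mu> \<omega>\<^sub>0" by blast
  obtain g where g: "bij_betw g {..<card X} X" "\<forall>i i'. i \<le> i' \<longrightarrow> i' < card X \<longrightarrow> p (g i') \<le> p (g i)"
    using decreasing_enumeration[OF X(1)] .
  obtain h where h: "bij_betw h {..<card Y} Y" "\<forall>j j'. j \<le> j' \<longrightarrow> j' < card Y \<longrightarrow> q (h j') \<le> q (h j)"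
    using decreasing_enumeration[OF Y(1)] .
  have sX: "schmidt_form \<chi> {..<card X} (p \<circ> g)" and sY: "schmidt_form \<upsilon> {..<card Y} (q \<circ> h)"
    using schmidt_form_reindex assms g(1) h(1) by blast+
  have p': "\<forall>i<card X. 0 < (p \<circ> g) i" "(\<Sum>i<card X. (p \<circ> g) i) = 1"
    "\<forall>i i'. i \<le> i' \<longrightarrow> i' < card X \<longrightarrow> (p \<circ> g) i' \<le> (p \<circ> g) i"
    using sX g(2) by (auto simp: schmidt_form_def)
  have q': "\<forall>j<card Y. 0 < (q \<circ> h) j" "(\<Sum>j<card Y. (q \<circ> h) j) = 1"
    "\<forall>j j'. j \<le> j' \<longrightarrow> j' < card Y \<longrightarrow> (q \<circ> h) j' \<le> (q \<circ> h) j"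
    using sY h(2) by (auto simp: schmidt_form_def)
  have D_eq: "D = 2 ^ Suc (nat \<lceil>\<mu>\<rceil>)" by (simp add: D_def c_def)
  obtain \<omega> where \<omega>: "\<And>i j. i < card X \<Longrightarrow> j < card Y \<Longrightarrow> 0 \<le> \<omega> i j"
    "\<And>i. i < card X \<Longrightarrow> (\<Sum>j<card Y. \<omega> i j) = (p \<circ> g) i"
    "\<And>j. j < card Y \<Longrightarrow> (\<Sum>i<card X. \<omega> i j) = (q \<circ> h) j"
    "\<And>i j j'. \<lbrakk>i < card X; j < card Y; j' < card Y; \<omega> i j \<noteq> 0; \<omega> i j' \<noteq> 0; (i + j) mod D = (i + j') mod D\<rbrakk> \<Longrightarrow> j = j'"
    "\<And>i i' j. \<lbrakk>i < card X; i' < card X; j < card Y; \<omega> i j \<noteq> 0; \<omega> i' j \<noteq> 0; (i + j) mod D = (i' + j) mod D\<rbrakk> \<Longrightarrow> i = i'"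
    by (rule colored_coupling[OF transport_plan_reindex[OF plan g(1) h(1)] p' q' D_eq])
      (rule that)
  have pos: "0 < dim_row \<chi>" "0 < dim_col \<chi>" "0 < dim_row \<upsilon>" "0 < dim_col \<upsilon>"
    using schmidt_form_dim_pos assms by blast+
  have D: "0 < D" by (simp add: D_def)
  text \<open>These ancilla sizes make the dimensions match after Alice has sent a \<open>D\<close>-dimensional register.\<close>
  define \<chi>' where "\<chi>' = append_A (dim_row \<upsilon> * D) (append_B (dim_col \<upsilon>) \<chi>)"
  define \<upsilon>' where "\<upsilon>' = append_A (dim_row \<chi>) (append_B (dim_col \<chi> * D) \<upsilon>)"
  have "move_step (Ancilla_A (dim_row \<upsilon> * D)) (append_B (dim_col \<upsilon>) \<chi>) \<chi>'"
    unfolding \<chi>'_def using pos D by (intro move_step.ancilla_A) simp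
  then have start: "executes [Ancilla_B (dim_col \<upsilon>), Ancilla_A (dim_row \<upsilon> * D)] \<chi> \<chi>'"
    using pos by (auto intro: executes.intros move_step.ancilla_B)
  have "\<exists>M. executes M \<chi>' \<upsilon>' \<and> qubit_cost M = c"
  proof (rule colored_coupling_conversion[where \<omega> = \<omega> and t = "\<lambda>i j. (i + j) mod D"])
    show "schmidt_form \<chi>' {..<card X} (p \<circ> g)" "schmidt_form \<upsilon>' {..<card Y} (q \<circ> h)"
      unfolding \<chi>'_def \<upsilon>'_def using sX sY pos D
      by (simp_all add: schmidt_form_append_A schmidt_form_append_B)
    show "dim_row \<chi>' = dim_row \<upsilon>' * 2 ^ c" "dim_col \<upsilon>' = dim_col \<chi>' * 2 ^ c"
      by (simp_all add: \<chi>'_def \<upsilon>'_def append_A_def append_B_def D_def mult_ac)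
  qed (use \<omega> D in \<open>simp_all add: D_def\<close>)
  then obtain M where M: "executes M \<chi>' \<upsilon>'" "qubit_cost M = c" by blast
  let ?M = "[Ancilla_B (dim_col \<upsilon>), Ancilla_A (dim_row \<upsilon> * D)] @ M"
  have "prepares ?M \<chi> \<upsilon>"
    unfolding prepares_def
  proof (intro exI conjI)
    show "0 < dim_row \<chi>" "0 < dim_col \<chi> * D" using pos D by simp_all
    show "executes ?M \<chi> (append_A (dim_row \<chi>) (append_B (dim_col \<chi> * D) \<upsilon>))"
      using executes_append[OF start M(1)] by (simp only: \<upsilon>'_def)
  qed
  moreover have "qubit_cost ?M = c" using M(2) by (simp add: qubit_cost_def)
  \<comment> \<open>Since \<mu> is nonnegative, \<open>int c\<close> equals
    \<open>\<lceil>\<mu>\<rceil> + 1\<close>, well within the claimed bound.\<close>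
  moreover have "int c \<le> 4 * \<lceil>\<mu>\<rceil> + 8" using \<mu> by (simp add: c_def)
  ultimately show ?thesis unfolding \<mu>_def by metis
qed

end
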